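(* For each $N$ in the Boltzmann-Grad scaling $N\varepsilon^{d-1}=1$ (so $\varepsilon=\varepsilon(N)>0$ is determined by $N$), let $f_N(t,Z_N)$ be a non-negative solution of the Liouville equation for $N$ identical hard spheres of diameter $\varepsilon$ in $\mathbb{R}^d$, i.e. $f_N(t,Z_N)=f_N(0,\psi_N^{-t}Z_N)$. Suppose that $f_N$ is symmetric under particle interchange, that $f_N$ is a probability density on $\mathcal{D}_N$, and that $$\sup_N \frac1N\int_{\mathcal{D}_N}\sum_{i=1}^N\left(|x_i|^2+|v_i|^2\right)f_N(0,Z_N)\,dZ_N<\infty .$$ Let $f(t)=f(t,x,v)$, $t\in[0,T]$, be a solution of the Boltzmann equation for hard spheres (as written in the context) which satisfies $$\forall t\in[0,T],\quad \int_{\mathbb{R}^{2d}}\left(x\cdot v-|v|^2t\right)f(t,x,v)\,dx\,dv=\int_{\mathbb{R}^{2d}}x\cdot v\,f(0,x,v)\,dx\,dv .$$ Assume moreover that $f(t)$ does not satisfy the free transport equation $(\partial_t+v\cdot\nabla_x)f=0$ on any open subinterval of $[0,T]$. Finally, assume that for each $t\in[0,T]$, $$\lim_{N\to\infty}f_N^{(1)}(t)=f(t)$$ in the sense of distributions. Then for any $T_1,T_2$ with $0\le T_1<T_2\le T$, $$\liminf_{N\to\infty}\ \varepsilon^{-1}\sup_{t\in[T_1,T_2]}\int_{\mathbb{R}^{2d}}\left(|x|^2+|v|^2\right)\left|f_N^{(1)}(t,x,v)-f(t,x,v)\right|dx\,dv>0 .$$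
   Context: Phase space: points are $Z_N=(z_1,\dots,z_N)=(X_N,V_N)\in\mathbb{R}^{2dN}$, with $z_i=(x_i,v_i)$, $X_N=(x_1,\dots,x_N)$ the positions and $V_N=(v_1,\dots,v_N)$ the velocities, $x_i,v_i\in\mathbb{R}^d$. For hard spheres of diameter $\varepsilon$, $$\mathcal{D}_N=\{Z_N\in\mathbb{R}^{2dN}:\ |x_i-x_j|>\varepsilon\ \ \forall\,1\le i<j\le N\}.$$ Hard sphere flow: $\psi_N^t$ ($t\in\mathbb{R}$) is the hard sphere flow, defined for almost every $Z_N\in\mathcal{D}_N$. Between collisions $\dot X_N=V_N$, $\dot V_N=0$. When particles $i<j$ collide, with $x_j=x_i+\varepsilon\omega$, $\omega\in\mathbb{S}^{d-1}$ (and no other pair in contact), the positions are continuous in time and the velocities $v_i,v_j$ just before the collision jump to $$v_i^*=v_i+\omega\,\big(\omega\cdot(v_j-v_i)\big),\qquad v_j^*=v_j-\omega\,\big(\omega\cdot(v_j-v_i)\big)$$ just after it, all other velocities being unchanged. Simultaneous collisions of more than two particles occur only for a null set of initial data. For every $t$ the map $\psi_N^t$ preserves Lebesgue measure on $\mathcal{D}_N$. Symmetry under particle interchange: $f_N(t,z_{\sigma(1)},\dots,z_{\sigma(N)})=f_N(t,z_1,\dots,z_N)$ for every permutation $\sigma$ of $\{1,\dots,N\}$. Marginals: $f_N(t)$ is extended by zero to $\mathbb{R}^{2dN}$, and the first marginal is $f_N^{(1)}(t,z_1)=\int_{\mathbb{R}^{2d(N-1)}}f_N(t,Z_N)\,dz_2\cdots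 dz_N$. Boltzmann equation for hard spheres: $(\partial_t+v\cdot\nabla_x)f=Q^+(f,f)-Q^-(f,f)$, where $$Q^+(f,f)(t,x,v)=\int_{\mathbb{R}^d\times\mathbb{S}^{d-1}}|\omega\cdot(v-v_2)|\,f(t,x,v^* )f(t,x,v_2^* )\,d\omega\,dv_2,$$ $$Q^-(f,f)(t,x,v)=\int_{\mathbb{R}^d\times\mathbb{S}^{d-1}}|\omega\cdot(v-v_2)|\,f(t,x,v)f(t,x,v_2)\,d\omega\,dv_2,$$ with $v^*=v+\omega\,(\omega\cdot(v_2-v))$ and $v_2^*=v_2-\omega\,(\omega\cdot(v_2-v))$. *)

theory Defs
  imports "HOL-Analysis.Analysis"
begin

section \<open>Hard spheres\<close>

text \<open>A configuration of $N$ particles is an extensional function on \<open>{1..N}\<close> whose value at \<open>i\<close>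
  is the pair $z_i = (x_i, v_i)$.\<close>

type_synonym 'a config = "nat \<Rightarrow> 'a \<times> 'a"

definition config_lebesgue :: "nat set \<Rightarrow> 'a::euclidean_space config measure" where
  "config_lebesgue I = completion (PiM I (\<lambda>_. lborel))"

definition hs_domain :: "real \<Rightarrow> nat \<Rightarrow> 'a::euclidean_space config set" where
  "hs_domain \<epsilon> N = {Z \<in> {1..N} \<rightarrow>\<^sub>E UNIV.
     \<forall>i\<in>{1..N}. \<forall>j\<in>{1..N}. i < j \<longrightarrow> norm (fst (Z i) - fst (Z j)) > \<epsilon>}"

definition hs_measure :: "real \<Rightarrow> nat \<Rightarrow> 'a::euclidean_space config measure" where
  "hs_measure \<epsilon> N = restrict_space (config_lebesgue {1..N}) (hs_domain \<epsilon> N)"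

definition hs_collision ::
  "real \<Rightarrow> nat \<Rightarrow> (real \<Rightarrow> 'a::euclidean_space config) \<Rightarrow> real \<Rightarrow> nat \<Rightarrow> nat \<Rightarrow> 'a \<Rightarrow> bool" where
  "hs_collision \<epsilon> N \<gamma> t i j \<omega> \<longleftrightarrow>
     i \<in> {1..N} \<and> j \<in> {1..N} \<and> i < j \<and> \<omega> \<in> sphere 0 1 \<and>
     fst (\<gamma> t j) = fst (\<gamma> t i) + \<epsilon> *\<^sub>R \<omega> \<and>
     (\<forall>k\<in>{1..N}. \<forall>l\<in>{1..N}. k < l \<and> (k, l) \<noteq> (i, j) \<longrightarrow> norm (fst (\<gamma> t k) - fst (\<gamma> t l)) > \<epsilon>) \<and>
     (\<exists>v v'.
        (\<forall>k\<in>{1..N}. ((\<lambda>s. snd (\<gamma> s k)) \<longlongrightarrow> v k) (at_left t)) \<and>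
        (\<forall>k\<in>{1..N}. ((\<lambda>s. snd (\<gamma> s k)) \<longlongrightarrow> v' k) (at_right t)) \<and>
        v' i = v i + (\<omega> \<bullet> (v j - v i)) *\<^sub>R \<omega> \<and>
        v' j = v j - (\<omega> \<bullet> (v j - v i)) *\<^sub>R \<omega> \<and>
        (\<forall>k\<in>{1..N} - {i, j}. v' k = v k))"

text \<open>The collision times of a trajectory are the times at which it leaves the open set
  \<open>hs_domain\<close>. At a collision time only the one-sided limits of the velocities are prescribed,
  not the value of the velocities at that very instant.\<close>

definition hs_trajectory :: "real \<Rightarrow> nat \<Rightarrow> (real \<Rightarrow> 'a::euclidean_space config) \<Rightarrow> bool" where
  "hs_trajectory \<epsilon> N \<gamma> \<longleftrightarrow>
     (\<forall>i\<in>{1..N}. continuous_on UNIV (\<lambda>t. fst (\<gamma> t i))) \<and>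
     (\<forall>a b. finite {t \<in> {a..b}. \<gamma> t \<notin> hs_domain \<epsilon> N}) \<and>
     (\<forall>t. \<gamma> t \<in> hs_domain \<epsilon> N \<longrightarrow>
        (\<forall>i\<in>{1..N}.
           ((\<lambda>s. fst (\<gamma> s i)) has_vector_derivative snd (\<gamma> t i)) (at t) \<and>
           ((\<lambda>s. snd (\<gamma> s i)) has_vector_derivative 0) (at t))) \<and>
     (\<forall>t. \<gamma> t \<notin> hs_domain \<epsilon> N \<longrightarrow> (\<exists>i j \<omega>. hs_collision \<epsilon> N \<gamma> t i j \<omega>))"

text \<open>The flow is only determined almost everywhere: \<open>\<psi> t Z\<close> is arbitrary when \<open>Z\<close> lies in an
  exceptional null set. For fixed \<open>t\<close>, the set of \<open>Z\<close> with a collision exactly at time \<open>t\<close>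
  is also null.\<close>

definition hs_flow :: "real \<Rightarrow> nat \<Rightarrow> (real \<Rightarrow> 'a::euclidean_space config \<Rightarrow> 'a config) \<Rightarrow> bool" where
  "hs_flow \<epsilon> N \<psi> \<longleftrightarrow>
     (AE Z in hs_measure \<epsilon> N. \<psi> 0 Z = Z \<and> hs_trajectory \<epsilon> N (\<lambda>t. \<psi> t Z)) \<and>
     (\<forall>s t. AE Z in hs_measure \<epsilon> N. \<psi> (s + t) Z = \<psi> s (\<psi> t Z)) \<and>
     (\<forall>t. (AE Z in hs_measure \<epsilon> N. \<psi> t Z \<in> hs_domain \<epsilon> N) \<and>
        (\<forall>A \<in> sets (hs_measure \<epsilon> N).
           \<psi> t -` A \<inter> hs_domain \<epsilon> N \<in> sets (hs_measure \<epsilon> N) \<and>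
           emeasure (hs_measure \<epsilon> N) (\<psi> t -` A \<inter> hs_domain \<epsilon> N) = emeasure (hs_measure \<epsilon> N) A))"

definition probability_density :: "'b measure \<Rightarrow> ('b \<Rightarrow> real) \<Rightarrow> bool" where
  "probability_density M g \<longleftrightarrow>
     g \<in> borel_measurable M \<and> (AE Z in M. 0 \<le> g Z) \<and> (\<integral>\<^sup>+ Z. ennreal (g Z) \<partial>M) = 1"

text \<open>The indicator function implements the extension by zero outside \<open>hs_domain\<close>.\<close>

definition first_marginal ::
  "real \<Rightarrow> nat \<Rightarrow> ('a::euclidean_space config \<Rightarrow> real) \<Rightarrow> 'a \<times> 'a \<Rightarrow> real" where
  "first_marginal \<epsilon> N g z =
     (\<integral>W. indicat_real (hs_domain \<epsilon> N) (W(1 := z)) * g (W(1 := z)) \<partial>config_lebesgue {2..N})"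


section \<open>Distributions\<close>

fun Ck :: "nat \<Rightarrow> ('b::euclidean_space \<Rightarrow> real) \<Rightarrow> bool" where
  "Ck 0 \<phi> \<longleftrightarrow> continuous_on UNIV \<phi>"
| "Ck (Suc k) \<phi> \<longleftrightarrow>
     (\<forall>x. \<phi> differentiable (at x)) \<and> (\<forall>e. Ck k (\<lambda>x. frechet_derivative \<phi> (at x) e))"

definition test_function :: "'b::euclidean_space set \<Rightarrow> ('b \<Rightarrow> real) \<Rightarrow> bool" where
  "test_function \<Omega> \<phi> \<longleftrightarrow> (\<forall>k. Ck k \<phi>) \<and>
     compact (closure {x. \<phi> x \<noteq> 0}) \<and> closure {x. \<phi> x \<noteq> 0} \<subseteq> \<Omega>"

definition locally_integrable :: "'b::euclidean_space set \<Rightarrow> ('b \<Rightarrow> real) \<Rightarrow> bool" where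
  "locally_integrable \<Omega> g \<longleftrightarrow> (\<forall>K. compact K \<and> K \<subseteq> \<Omega> \<longrightarrow> g absolutely_integrable_on K)"

definition tendsto_distribution :: "(nat \<Rightarrow> 'b::euclidean_space \<Rightarrow> real) \<Rightarrow> ('b \<Rightarrow> real) \<Rightarrow> bool" where
  "tendsto_distribution G g \<longleftrightarrow>
     (\<forall>\<phi>. test_function UNIV \<phi> \<longrightarrow>
        (\<lambda>N. \<integral>z. G N z * \<phi> z \<partial>lebesgue) \<longlonglongrightarrow> (\<integral>z. g z * \<phi> z \<partial>lebesgue))"


section \<open>The Boltzmann equation\<close>

text \<open>Surface measure on the unit sphere, as a measure on the ambient space concentrated on the
  sphere. By integration in polar coordinates, the area of a Borel set $A \subseteq S^{d-1}$ is
  $d$ times the volume of the cone $\{r\omega \mid 0 < r < 1, \omega \in A\}$. Here \<open>sgn x\<close> is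
  $x/|x|$.\<close>

definition sphere_measure :: "'a::euclidean_space measure" where
  "sphere_measure =
     distr (density lborel (\<lambda>x. of_nat DIM('a) * indicator (ball 0 1) x)) borel sgn"

text \<open>Integration variables are the pairs $(v_2, \omega)$.\<close>

definition collision_measure :: "('a::euclidean_space \<times> 'a) measure" where
  "collision_measure = completion (lborel \<Otimes>\<^sub>M sphere_measure)"

definition gain_integrand ::
  "('a::euclidean_space \<times> 'a \<Rightarrow> real) \<Rightarrow> 'a \<times> 'a \<Rightarrow> 'a \<times> 'a \<Rightarrow> real" where
  "gain_integrand g = (\<lambda>(x, v) (v2, \<omega>). \<bar>\<omega> \<bullet> (v - v2)\<bar> *
     g (x, v + (\<omega> \<bullet> (v2 - v)) *\<^sub>R \<omega>) * g (x, v2 - (\<omega> \<bullet> (v2 - v)) *\<^sub>R \<omega>))"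

definition loss_integrand ::
  "('a::euclidean_space \<times> 'a \<Rightarrow> real) \<Rightarrow> 'a \<times> 'a \<Rightarrow> 'a \<times> 'a \<Rightarrow> real" where
  "loss_integrand g = (\<lambda>(x, v) (v2, \<omega>). \<bar>\<omega> \<bullet> (v - v2)\<bar> * g (x, v) * g (x, v2))"

definition Qplus :: "('a::euclidean_space \<times> 'a \<Rightarrow> real) \<Rightarrow> 'a \<times> 'a \<Rightarrow> real" where
  "Qplus g z = (\<integral>p. gain_integrand g z p \<partial>collision_measure)"

definition Qminus :: "('a::euclidean_space \<times> 'a \<Rightarrow> real) \<Rightarrow> 'a \<times> 'a \<Rightarrow> real" where
  "Qminus g z = (\<integral>p. loss_integrand g z p \<partial>collision_measure)"

text \<open>The equation $(\partial_t + v\cdot\nabla_x) f = h$ in the sense of distributions on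
  $(a,b) \times \<real>^{2d}$. The expression $(\partial_t + v\cdot\nabla_x)\varphi$ at $(t,x,v)$ is
  the derivative of $\varphi$ in the direction $(1,v,0)$.\<close>

definition transport_equation ::
  "real \<Rightarrow> real \<Rightarrow> (real \<Rightarrow> 'a::euclidean_space \<times> 'a \<Rightarrow> real) \<Rightarrow> (real \<Rightarrow> 'a \<times> 'a \<Rightarrow> real) \<Rightarrow> bool" where
  "transport_equation a b f h \<longleftrightarrow>
     (\<forall>\<phi>. test_function ({a<..<b} \<times> UNIV) \<phi> \<longrightarrow>
        - (\<integral>(t, x, v). f t (x, v) * frechet_derivative \<phi> (at (t, x, v)) (1, v, 0) \<partial>lebesgue)
        = (\<integral>(t, x, v). h t (x, v) * \<phi> (t, x, v) \<partial>lebesgue))"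

definition boltzmann_solution :: "real \<Rightarrow> (real \<Rightarrow> 'a::euclidean_space \<times> 'a \<Rightarrow> real) \<Rightarrow> bool" where
  "boltzmann_solution T f \<longleftrightarrow>
     (\<forall>t\<in>{0..T}. locally_integrable UNIV (f t)) \<and>
     locally_integrable ({0<..<T} \<times> UNIV) (\<lambda>(t, z). f t z) \<and>
     (AE (t, z) in lebesgue. t \<in> {0<..<T} \<longrightarrow>
        integrable collision_measure (gain_integrand (f t) z) \<and>
        integrable collision_measure (loss_integrand (f t) z)) \<and>
     locally_integrable ({0<..<T} \<times> UNIV) (\<lambda>(t, z). Qplus (f t) z) \<and>
     locally_integrable ({0<..<T} \<times> UNIV) (\<lambda>(t, z). Qminus (f t) z) \<and>
     transport_equation 0 T f (\<lambda>t z. Qplus (f t) z - Qminus (f t) z)"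

definition free_transport_on ::
  "real \<Rightarrow> real \<Rightarrow> (real \<Rightarrow> 'a::euclidean_space \<times> 'a \<Rightarrow> real) \<Rightarrow> bool" where
  "free_transport_on a b f \<longleftrightarrow> transport_equation a b f (\<lambda>t z. 0)"

end

theory Submission
  imports Defs
begin

text \<open>Along a hard sphere trajectory the virial \<open>q(t) = \<Sum>\<^sub>i (x\<^sub>i \<bullet> v\<^sub>i - t |v\<^sub>i|\<^sup>2)\<close> is constant
  between collisions and increases at a collision by exactly $\varepsilon$ times the transferred
  momentum $|\omega\cdot(v_j-v_i)|$. The same momentum transfer bounds the jump of any sum
  \<open>\<Sum>\<^sub>i \<phi>(t, z\<^sub>i)\<close> with \<open>\<phi>\<close> Lipschitz, so the failure of the first marginal to solve free transport
  on \<open>(T1, T2)\<close> is at most $2L\varepsilon^{-1}$ times the increase of the mean virial. The limit has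
  constant virial. Hence if the second moments of the difference were \<open>o(\<epsilon>)\<close> along a
  subsequence, the limit would solve free transport on \<open>(T1, T2)\<close>.\<close>

section \<open>Test functions\<close>

text \<open>Colliding particles approach each other before contact, so all jumps of the virial have
  the same sign: along a trajectory its net increase is \<epsilon> times the total momentum
  transferred, with no cancellation. Momentum transfer is not an observable of the first marginal,
  but the virial is, and |x . v - t |v|^2| is at most (1 + T)(|x|^2 + |v|^2) for t in [0, T]. This
  explains the quadratic weight and the rate: a weighted distance below \<eta> \<epsilon> at both
  end times bounds the increase of the mean virial by a multiple of \<eta> \<epsilon>, and division
  by \<epsilon> leaves a defect of order \<eta> in free transport. The obstacles are measure
  theoretic. Flow, densities and marginals are pinned down almost everywhere only, and densities are
  measurable for a completed product measure; they are replaced by measurable representatives before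
  product theorems are applied. Measurability of the flow is given at each fixed time only, so time
  integrals of observables enter as limits of sums over a grid.\<close>

lemma Ck_Suc_imp_Ck: "Ck (Suc k) \<phi> \<Longrightarrow> Ck k \<phi>"
  for \<phi> :: "'b::euclidean_space \<Rightarrow> real"
proof (induction k arbitrary: \<phi>)
  case 0
  then show ?case
    by (simp add: continuous_at_imp_continuous_on differentiable_imp_continuous_within)
qed simp

lemma Ck_bounded_linear: "bounded_linear \<phi> \<Longrightarrow> Ck k \<phi>"
  for \<phi> :: "'b::euclidean_space \<Rightarrow> real"
proof -
  have const: "Ck k (\<lambda>_::'b. c)" for c :: real and k
    by (induction k arbitrary: c) auto
  assume b: "bounded_linear \<phi>"
  then have d: "(\<phi> has_derivative \<phi>) (at x)" for x
    by (rule bounded_linear_imp_has_derivative)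
  then have fd: "frechet_derivative \<phi> (at x) = \<phi>" for x
    by (metis frechet_derivative_at)
  show ?thesis
    using d b by (cases k) (auto simp: fd const differentiable_def linear_continuous_on)
qed

lemma Ck_add: "Ck k \<phi> \<Longrightarrow> Ck k \<theta> \<Longrightarrow> Ck k (\<lambda>x. \<phi> x + \<theta> x)"
  for \<phi> :: "'b::euclidean_space \<Rightarrow> real"
proof (induction k arbitrary: \<phi> \<theta>)
  case 0
  then show ?case by (simp add: continuous_on_add)
next
  case (Suc k)
  then have "\<phi> differentiable (at x)" "\<theta> differentiable (at x)" for x by auto
  then have "frechet_derivative (\<lambda>x. \<phi> x + \<theta> x) (at x) =
      (\<lambda>e. frechet_derivative \<phi> (at x) e + frechet_derivative \<theta> (at x) e)" for x
    by (intro frechet_derivative_at[symmetric] has_derivative_add) (simp_all add: frechet_derivative_works[symmetric])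
  then show ?case using Suc by auto
qed

lemma Ck_mult: "Ck k \<phi> \<Longrightarrow> Ck k \<theta> \<Longrightarrow> Ck k (\<lambda>x. \<phi> x * \<theta> x)"
  for \<phi> :: "'b::euclidean_space \<Rightarrow> real"
proof (induction k arbitrary: \<phi> \<theta>)
  case 0
  then show ?case by (simp add: continuous_on_mult)
next
  case (Suc k)
  then have "\<phi> differentiable (at x)" "\<theta> differentiable (at x)" for x by auto
  then have "frechet_derivative (\<lambda>x. \<phi> x * \<theta> x) (at x) =
      (\<lambda>e. \<phi> x * frechet_derivative \<theta> (at x) e + frechet_derivative \<phi> (at x) e * \<theta> x)" for x
    by (intro frechet_derivative_at[symmetric] has_derivative_mult) (simp_all add: frechet_derivative_works[symmetric])
  \<comment> \<open>The product rule leaves one factor undifferentiated in each term, so the factors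
    themselves are needed at the lower level k.\<close>
  moreover have "Ck k \<phi>" "Ck k \<theta>" using Suc.prems by (auto intro: Ck_Suc_imp_Ck)
  ultimately show ?case using Suc by (auto intro!: Ck_add)
qed

lemma Ck_sum: "(\<And>i. i \<in> I \<Longrightarrow> Ck k (\<phi> i)) \<Longrightarrow> Ck k (\<lambda>x. \<Sum>i\<in>I. \<phi> i x)"
  for \<phi> :: "'i \<Rightarrow> 'b::euclidean_space \<Rightarrow> real"
proof (induction I rule: infinite_finite_induct)
  case (insert i I)
  then show ?case by (simp add: Ck_add)
qed (auto intro!: Ck_bounded_linear)

lemma Ck_slice: "Ck k \<phi> \<Longrightarrow> Ck k (\<lambda>z. \<phi> (t, z))"
  for \<phi> :: "'c::euclidean_space \<times> 'b::euclidean_space \<Rightarrow> real"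
proof (induction k arbitrary: \<phi>)
  case 0
  then show ?case by (auto intro!: continuous_intros continuous_on_compose2[of UNIV \<phi>])
next
  case (Suc k)
  have "((\<lambda>z. \<phi> (t, z)) has_derivative (\<lambda>e. frechet_derivative \<phi> (at (t, z)) (0, e))) (at z)" for z
  proof -
    have "(Pair t has_derivative (\<lambda>e. (0, e))) (at z)"
      by (auto intro!: derivative_eq_intros)
    moreover have "(\<phi> has_derivative frechet_derivative \<phi> (at (t, z))) (at (t, z))"
      using Suc.prems by (simp add: frechet_derivative_works[symmetric])
    ultimately show ?thesis
      using diff_chain_at[of "Pair t" _ z \<phi>] by (simp add: o_def)
  qed
  then have "(\<lambda>z. \<phi> (t, z)) differentiable (at z)"
    "frechet_derivative (\<lambda>z. \<phi> (t, z)) (at z) = (\<lambda>e. frechet_derivative \<phi> (at (t, z)) (0, e))" for z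
    by (auto simp: differentiable_def intro: frechet_derivative_at[symmetric])
  moreover have "Ck k (\<lambda>z. frechet_derivative \<phi> (at (t, z)) (0, e))" for e
    using Suc.IH[of "\<lambda>p. frechet_derivative \<phi> (at p) (0, e)"] Suc.prems by simp
  ultimately show ?case by simp
qed

section \<open>The transport derivative of a test function\<close>

definition transport_derivative ::
  "(real \<times> 'a::euclidean_space \<times> 'a \<Rightarrow> real) \<Rightarrow> real \<times> 'a \<times> 'a \<Rightarrow> real" where
  "transport_derivative \<phi> p = frechet_derivative \<phi> (at p) (1, snd (snd p), 0)"

text \<open>\<open>Ck\<close> speaks of derivatives in fixed directions, whereas the direction (1,
  v, 0) moves with the base point. Expanding v in the basis turns this dependence into linear
  coefficients, which are smooth.\<close>

lemma transport_derivative_expand: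
  assumes "\<phi> differentiable (at p)"
  shows "transport_derivative \<phi> p = frechet_derivative \<phi> (at p) (1, 0, 0) +
    (\<Sum>b\<in>Basis. (snd (snd p) \<bullet> b) * frechet_derivative \<phi> (at p) (0, b, 0))"
proof -
  interpret linear "frechet_derivative \<phi> (at p)"
    using assms by (rule linear_frechet_derivative)
  have "(1, snd (snd p), 0) = (1, 0, 0) + (\<Sum>b\<in>Basis. (snd (snd p) \<bullet> b) *\<^sub>R (0::real, b, 0::'a))"
    by (auto simp: prod_eq_iff fst_sum snd_sum euclidean_representation)
  then show ?thesis
    unfolding transport_derivative_def by (simp only: add sum scale) simp
qed

lemma Ck_transport_derivative:
  assumes "Ck (Suc k) \<phi>"
  shows "Ck k (transport_derivative \<phi>)"
proof -
  have "transport_derivative \<phi> = (\<lambda>p. frechet_derivative \<phi> (at p) (1, 0, 0) +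
    (\<Sum>b\<in>Basis. (snd (snd p) \<bullet> b) * frechet_derivative \<phi> (at p) (0, b, 0)))"
    using assms by (intro ext transport_derivative_expand) auto
  moreover have "Ck k \<dots>"
    using assms
    by (intro Ck_add Ck_sum Ck_mult Ck_bounded_linear[of "\<lambda>p. snd (snd p) \<bullet> b" for b]
      bounded_linear_intros) auto
  ultimately show ?thesis by simp
qed

lemma frechet_derivative_zero_outside_support:
  fixes \<phi> :: "'b::euclidean_space \<Rightarrow> real"
  assumes "p \<notin> closure {x. \<phi> x \<noteq> 0}"
  shows "frechet_derivative \<phi> (at p) e = 0"
proof -
  have "(\<phi> has_derivative (\<lambda>_. 0)) (at p)"
  proof (rule has_derivative_transform_within_open[of "\<lambda>_. 0" _ _ _ "- closure {x. \<phi> x \<noteq> 0}"])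
    show "(\<And>x. x \<in> - closure {x. \<phi> x \<noteq> 0} \<Longrightarrow> 0 = \<phi> x)"
      using closure_subset by force
  qed (use assms in auto)
  then show ?thesis by (metis frechet_derivative_at)
qed

text \<open>Convergence in the sense of distributions is available at each fixed time, on phase
  space alone, so time is frozen here. The coefficient v is unbounded, but the derivatives of \<phi>
  vanish outside a compact set.\<close>

lemma test_function_transport_derivative_slice:
  assumes "test_function \<Omega> \<phi>"
  shows "test_function UNIV (\<lambda>z. transport_derivative \<phi> (t, z))"
proof -
  define K where "K = closure {x. \<phi> x \<noteq> 0}"
  have K: "compact K" using assms by (simp add: test_function_def K_def)
  have sub: "{z. transport_derivative \<phi> (t, z) \<noteq> 0} \<subseteq> snd ` K"
  proof clarify
    fix x v assume "transport_derivative \<phi> (t, x, v) \<noteq> 0"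
    then have "(t, x, v) \<in> K"
      using frechet_derivative_zero_outside_support[of "(t, x, v)" \<phi>]
      by (auto simp: K_def transport_derivative_def)
    then show "(x, v) \<in> snd ` K" by force
  qed
  moreover have "compact (snd ` K)" using K by (intro compact_continuous_image continuous_intros)
  ultimately have "compact (closure {z. transport_derivative \<phi> (t, z) \<noteq> 0})"
    by (meson bounded_subset compact_closure compact_imp_bounded)
  moreover have "Ck k (\<lambda>z. transport_derivative \<phi> (t, z))" for k
    using assms by (intro Ck_slice Ck_transport_derivative) (auto simp: test_function_def simp del: Ck.simps)
  ultimately show ?thesis by (simp add: test_function_def)
qed

lemma bounded_of_compact_support:
  fixes h :: "'b::euclidean_space \<Rightarrow> real"
  assumes "continuous_on UNIV h" "compact K" "\<And>p. p \<notin> K \<Longrightarrow> h p = 0"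
  obtains M where "M > 0" "\<And>p. \<bar>h p\<bar> \<le> M"
proof -
  have "compact (h ` K)"
    using assms by (intro compact_continuous_image) (auto intro: continuous_on_subset)
  then have "bounded (h ` K)" by (rule compact_imp_bounded)
  then obtain M where "M > 0" "\<And>p. p \<in> K \<Longrightarrow> \<bar>h p\<bar> \<le> M"
    by (auto simp: bounded_pos)
  moreover have "\<bar>h p\<bar> \<le> M" if "p \<notin> K" for p
    using assms(3)[OF that] \<open>M > 0\<close> by simp
  ultimately show thesis using that by blast
qed

text \<open>Each partial derivative is continuous with compact support, hence bounded; the sum of
  these bounds over the basis dominates the operator norm of the derivative.\<close>

lemma test_function_lipschitz:
  fixes \<phi> :: "'b::euclidean_space \<Rightarrow> real"
  assumes "test_function \<Omega> \<phi>"
  obtains L where "L > 0" "\<And>p q. \<bar>\<phi> p - \<phi> q\<bar> \<le> L * norm (p - q)"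
proof -
  have C1: "Ck (Suc 0) \<phi>" and K: "compact (closure {x. \<phi> x \<noteq> 0})"
    using assms unfolding test_function_def by blast+
  have "\<exists>M>0. \<forall>p. \<bar>frechet_derivative \<phi> (at p) b\<bar> \<le> M" for b
  proof -
    have "continuous_on UNIV (\<lambda>p. frechet_derivative \<phi> (at p) b)" using C1 by simp
    from bounded_of_compact_support[OF this K frechet_derivative_zero_outside_support]
    show ?thesis by blast
  qed
  then obtain M where M: "\<And>b. M b > 0" "\<And>b p. \<bar>frechet_derivative \<phi> (at p) b\<bar> \<le> M b" by metis
  \<comment> \<open>The summand 1 keeps the constant away from 0 at no cost.\<close>
  define L where "L = 1 + (\<Sum>b\<in>(Basis :: 'b set). M b)"
  have "onorm (frechet_derivative \<phi> (at p)) \<le> L" for p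
  proof (rule onorm_le)
    fix x
    interpret linear "frechet_derivative \<phi> (at p)"
      using C1 by (intro linear_frechet_derivative) auto
    have "frechet_derivative \<phi> (at p) x = frechet_derivative \<phi> (at p) (\<Sum>b\<in>Basis. (x \<bullet> b) *\<^sub>R b)"
      by (simp add: euclidean_representation)
    also have "\<dots> = (\<Sum>b\<in>Basis. (x \<bullet> b) * frechet_derivative \<phi> (at p) b)"
      by (simp add: sum scale)
    also have "norm \<dots> \<le> (\<Sum>b\<in>(Basis::'b set). norm x * M b)"
      by (intro sum_norm_le) (auto simp: abs_mult intro!: mult_mono M Basis_le_norm)
    also have "\<dots> \<le> L * norm x"
      by (simp add: L_def sum_distrib_right[symmetric] distrib_right mult.commute[of "norm x"])
    finally show "norm (frechet_derivative \<phi> (at p) x) \<le> L * norm x" .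
  qed
  then have "norm (\<phi> p - \<phi> q) \<le> L * norm (p - q)" for p q
    using C1 by (intro differentiable_bound[of UNIV \<phi> "\<lambda>p. frechet_derivative \<phi> (at p)"])
      (auto simp: frechet_derivative_works[symmetric])
  moreover have "L > 0" unfolding L_def using M(1) by (simp add: add_pos_nonneg less_imp_le sum_nonneg)
  ultimately show thesis using that by auto
qed

section \<open>Hard sphere trajectories\<close>

text \<open>Away from S the function is locally constant, and each jump goes upwards. At points of S
  only one-sided limits occur, never the value of \<open>G\<close>: a trajectory leaves the
  velocities at a collision time itself unspecified. The induction removes the last jump.\<close>

lemma jump_mono:
  fixes G :: "real \<Rightarrow> real"
  assumes "finite S" "S \<subseteq> {a<..<b}" "a < b"
    and deriv: "\<And>t. t \<in> {a..b} - S \<Longrightarrow> (G has_real_derivative 0) (at t within {a..b})"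
    and jump: "\<And>t. t \<in> S \<Longrightarrow>
      \<exists>l r. (G \<longlongrightarrow> l) (at_left t) \<and> (G \<longlongrightarrow> r) (at_right t) \<and> l \<le> r"
  shows "G a \<le> G b"
  using assms
proof (induction "card S" arbitrary: S b rule: less_induct)
  case less
  have const: "G u = G v" if "a \<le> u" "u \<le> v" "v \<le> b" "{u..v} \<inter> S = {}" for u v
  proof (cases "u < v")
    case True
    have "(G has_real_derivative 0) (at t within {u..v})" if "t \<in> {u..v}" for t
    proof (rule DERIV_subset)
      show "(G has_real_derivative 0) (at t within {a..b})"
        using that \<open>a \<le> u\<close> \<open>v \<le> b\<close> \<open>{u..v} \<inter> S = {}\<close> by (intro less.prems(4)) auto
    qed (use \<open>a \<le> u\<close> \<open>v \<le> b\<close> in auto)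
    then have "\<exists>c. \<forall>t\<in>{u..v}. G t = c"
      by (intro has_field_derivative_zero_constant) auto
    then show ?thesis using True by auto
  qed (use that in auto)
  show ?case
  proof (cases "S = {}")
    case True
    then show ?thesis using const[of a b] less.prems by auto
  next
    case False
    define c where "c = Max S"
    have c: "c \<in> S" "\<And>s. s \<in> S \<Longrightarrow> s \<le> c" "a < c" "c < b"
      using less.prems Max_in[OF less.prems(1) False] Max_ge[OF less.prems(1)]
      unfolding c_def by auto
    obtain l r where lr: "(G \<longlongrightarrow> l) (at_left c)" "(G \<longlongrightarrow> r) (at_right c)" "l \<le> r"
      using less.prems(5)[OF c(1)] by blast
    have "eventually (\<lambda>t. G t = G b) (at_right c)"
      unfolding eventually_at_right_field
    proof (intro exI[of _ b] conjI allI impI)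
      show "G y = G b" if "c < y" "y < b" for y
        using that c by (intro const) force+
    qed (use c in auto)
    then have r: "r = G b"
      using tendsto_unique[OF _ lr(2) tendsto_eventually] by auto
    \<comment> \<open>\<open>p\<close> is the last jump before \<open>c\<close>, or \<open>a\<close>
      if there is none. The midpoint \<open>m\<close> of \<open>p\<close> and \<open>c\<close> is
      then past all earlier jumps, so \<open>G\<close> keeps the value \<open>G m\<close> up to
      \<open>c\<close> and the left limit at \<open>c\<close> is \<open>G m\<close>.\<close>
    define p where "p = Max (insert a (S - {c}))"
    have fin: "finite (insert a (S - {c}))" using less.prems by auto
    have "p \<in> insert a (S - {c})" unfolding p_def by (rule Max_in[OF fin]) auto
    then have p: "a \<le> p" "p < c" using c less.prems by force+
    have pS: "s \<le> p" if "s \<in> S" "s \<noteq> c" for s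
      unfolding p_def using that by (intro Max_ge[OF fin]) auto
    define m where "m = (p + c) / 2"
    have m: "p < m" "m < c" using p by (auto simp: m_def)
    have "eventually (\<lambda>t. G t = G m) (at_left c)"
      unfolding eventually_at_left_field
    proof (intro exI[of _ m] conjI allI impI)
      show "G y = G m" if "m < y" "y < c" for y
      proof (rule sym, intro const)
        show "{m..y} \<inter> S = {}" using pS m that by force
      qed (use that m p c in auto)
    qed (use m in auto)
    then have l: "l = G m"
      using tendsto_unique[OF _ lr(1) tendsto_eventually] by auto
    have "G a \<le> G m"
    proof (rule less.hyps[of "S \<inter> {a<..<m}" m])
      show "card (S \<inter> {a<..<m}) < card S"
      proof (rule psubset_card_mono)
        have "c \<notin> S \<inter> {a<..<m}" using m by auto
        then show "S \<inter> {a<..<m} \<subset> S" using c(1) by blast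
      qed (rule less.prems)
      show "(G has_real_derivative 0) (at t within {a..m})" if "t \<in> {a..m} - S \<inter> {a<..<m}" for t
      proof (rule DERIV_subset)
        have "t \<notin> S" using that less.prems(2) pS[of t] m by (cases "t = m") force+
        then show "(G has_real_derivative 0) (at t within {a..b})"
          using less.prems(4)[of t] that m c by auto
      qed (use m c in auto)
    qed (use less.prems m p in auto)
    then show ?thesis using l r lr by simp
  qed
qed

text \<open>Chain rule: in free flight the curve (s, x, v) has tangent (1, v, 0), so the time
  derivative of an observable along it is its transport derivative.\<close>

lemma has_real_derivative_along_curve:
  fixes \<phi> :: "real \<times> 'a::euclidean_space \<times> 'a \<Rightarrow> real"
  assumes "\<phi> differentiable (at (t, x t, v t))"
    and "(x has_vector_derivative v t) (at t)" "(v has_vector_derivative 0) (at t)"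
  shows "((\<lambda>s. \<phi> (s, x s, v s)) has_real_derivative
    frechet_derivative \<phi> (at (t, x t, v t)) (1, v t, 0)) (at t)"
proof -
  have "((\<lambda>s. (s, x s, v s)) has_vector_derivative (1, v t, 0)) (at t)"
    using assms by (intro has_vector_derivative_Pair) (auto intro!: derivative_eq_intros)
  moreover have "(\<phi> has_derivative frechet_derivative \<phi> (at (t, x t, v t))) (at (t, x t, v t))"
    using assms(1) by (simp add: frechet_derivative_works)
  ultimately have "((\<lambda>s. \<phi> (s, x s, v s)) has_derivative
      (\<lambda>h. frechet_derivative \<phi> (at (t, x t, v t)) (h *\<^sub>R (1, v t, 0)))) (at t)"
    using has_derivative_compose[of "\<lambda>s. (s, x s, v s)" _ t UNIV \<phi>]
    by (simp add: has_vector_derivative_def)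
  moreover have "frechet_derivative \<phi> (at (t, x t, v t)) (h *\<^sub>R (1, v t, 0)) =
      frechet_derivative \<phi> (at (t, x t, v t)) (1, v t, 0) * h" for h
    using linear_scale[OF linear_frechet_derivative[OF assms(1)], of h "(1, v t, 0)"] by simp
  ultimately show ?thesis by (simp add: has_field_derivative_def)
qed

section \<open>The virial and the momentum transferred in a collision\<close>

text \<open>Each summand is (x - t v) . v, the velocity paired with the position traced back to time
  0 by free flight, and is therefore constant in free flight.\<close>

definition virial :: "nat \<Rightarrow> real \<Rightarrow> 'a::euclidean_space config \<Rightarrow> real" where
  "virial N t Z = (\<Sum>i=1..N. fst (Z i) \<bullet> snd (Z i) - (norm (snd (Z i)))\<^sup>2 * t)"

lemma sum_eq_two:
  fixes g :: "nat \<Rightarrow> real"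
  assumes "finite I" "i \<in> I" "j \<in> I" "i \<noteq> j" "\<And>k. k \<in> I - {i, j} \<Longrightarrow> g k = 0"
  shows "sum g I = g i + g j"
proof -
  have "sum g I = sum g {i, j}"
    using assms by (intro sum.mono_neutral_right) auto
  then show ?thesis using assms by simp
qed

text \<open>\<open>hs_collision\<close> does not state that the particles approach each other; this
  follows from the exclusion condition. If the relative velocity pointed outwards just before
  contact, the distance would be increasing up to its final value \<epsilon>, so the pair would have
  overlapped earlier.\<close>

lemma hs_collision_incoming:
  assumes traj: "hs_trajectory \<epsilon> N \<gamma>" and "\<epsilon> > 0"
    and ij: "i \<in> {1..N}" "j \<in> {1..N}" "i < j" and \<omega>: "norm \<omega> = 1"
    and contact: "fst (\<gamma> t j) = fst (\<gamma> t i) + \<epsilon> *\<^sub>R \<omega>"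
    and v: "((\<lambda>s. snd (\<gamma> s i)) \<longlongrightarrow> vi) (at_left t)" "((\<lambda>s. snd (\<gamma> s j)) \<longlongrightarrow> vj) (at_left t)"
  shows "\<omega> \<bullet> (vj - vi) \<le> 0"
proof (rule ccontr)
  assume "\<not> \<omega> \<bullet> (vj - vi) \<le> 0"
  then have pos: "\<omega> \<bullet> (vj - vi) > 0" by simp
  define r where "r s = fst (\<gamma> s j) - fst (\<gamma> s i)" for s
  define w where "w s = snd (\<gamma> s j) - snd (\<gamma> s i)" for s
  have cont: "continuous_on UNIV r"
    using traj ij unfolding hs_trajectory_def r_def by (intro continuous_on_diff) auto
  have rt: "r t = \<epsilon> *\<^sub>R \<omega>" using contact by (simp add: r_def)
  have "(r \<longlongrightarrow> r t) (at_left t)"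
    using cont by (metis UNIV_I continuous_on_def subset_UNIV tendsto_within_subset)
  moreover have "(w \<longlongrightarrow> vj - vi) (at_left t)"
    unfolding w_def by (intro tendsto_intros v)
  ultimately have "((\<lambda>s. r s \<bullet> w s) \<longlongrightarrow> r t \<bullet> (vj - vi)) (at_left t)"
    by (intro tendsto_intros)
  moreover have "r t \<bullet> (vj - vi) > 0" using pos \<open>\<epsilon> > 0\<close> by (simp add: rt)
  ultimately have "eventually (\<lambda>s. r s \<bullet> w s > 0) (at_left t)"
    by (rule order_tendstoD)
  moreover have fin: "finite {s \<in> {t-1..t}. \<gamma> s \<notin> hs_domain \<epsilon> N}"
    using traj unfolding hs_trajectory_def by blast
  \<comment> \<open>Collision times are finite in number on bounded intervals, so none other than
    \<open>t\<close> occurs in a small left neighbourhood, and the motion there is free.\<close>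
  have "eventually (\<lambda>s. s \<notin> {s \<in> {t-1..t}. \<gamma> s \<notin> hs_domain \<epsilon> N} - {t}) (at_left t)"
  proof -
    have "open (- ({s \<in> {t-1..t}. \<gamma> s \<notin> hs_domain \<epsilon> N} - {t}))"
      using fin by (intro open_Compl finite_imp_closed) auto
    from eventually_at_in_open'[OF this, of t] show ?thesis
      by (rule eventually_at_split[THEN iffD1, THEN conjunct1, OF eventually_mono]) auto
  qed
  moreover have "eventually (\<lambda>s. s \<in> {t-1<..<t}) (at_left t)"
    by (rule eventually_at_left_real) simp
  ultimately have "eventually (\<lambda>s. s < t \<and> r s \<bullet> w s > 0 \<and> \<gamma> s \<in> hs_domain \<epsilon> N) (at_left t)"
    by eventually_elim auto
  then obtain b where b: "b < t" "\<And>s. b < s \<Longrightarrow> s < t \<Longrightarrow> r s \<bullet> w s > 0 \<and> \<gamma> s \<in> hs_domain \<epsilon> N"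
    unfolding eventually_at_left_field by blast
  define c where "c = (b + t) / 2"
  have c: "b < c" "c < t" using b by (auto simp: c_def)
  \<comment> \<open>The velocity may jump at \<open>t\<close>, so derivatives are used in the open
    interval only and the end point is reached by continuity of the positions.\<close>
  have "r c \<bullet> r c < r t \<bullet> r t"
  proof (rule DERIV_pos_imp_increasing_open[of c t])
    fix s assume s: "c < s" "s < t"
    then have D: "\<gamma> s \<in> hs_domain \<epsilon> N" and p: "r s \<bullet> w s > 0" using b c by auto
    have "(r has_vector_derivative w s) (at s)"
      unfolding r_def w_def using traj D ij unfolding hs_trajectory_def
      by (intro has_vector_derivative_diff) auto
    then have "((\<lambda>s. r s \<bullet> r s) has_vector_derivative r s \<bullet> w s + w s \<bullet> r s) (at s)"
      unfolding has_vector_derivative_def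
      by (auto intro!: derivative_eq_intros simp: inner_commute algebra_simps)
    then show "\<exists>y. ((\<lambda>s. r s \<bullet> r s) has_real_derivative y) (at s) \<and> 0 < y"
      using p by (auto simp: has_real_derivative_iff_has_vector_derivative inner_commute)
  next
    show "continuous_on {c..t} (\<lambda>s. r s \<bullet> r s)"
      by (intro continuous_intros continuous_on_subset[OF cont]) auto
  qed (use c in auto)
  also have "r t \<bullet> r t = \<epsilon>\<^sup>2" using \<omega> by (simp add: rt power2_eq_square dot_square_norm)
  finally have "norm (r c) < \<epsilon>"
    by (metis \<open>0 < \<epsilon>\<close> less_eq_real_def power2_less_imp_less power2_norm_eq_inner)
  moreover have "norm (r c) > \<epsilon>"
    using b(2)[OF c] ij unfolding hs_domain_def r_def by (auto simp: norm_minus_commute)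
  ultimately show False by simp
qed

text \<open>Only \<open>i\<close> and \<open>j\<close> change velocity, by c \<omega> and - c
  \<omega> with c = \<omega> . (v_j - v_i) \<le> 0. Their centres differ by \<epsilon> \<omega>, so
  the virial rises by - \<epsilon> c = \<epsilon> |c|. Each of the two particles changes the sum of
  \<phi> by at most L |c|, which gives the factor 2.\<close>

lemma hs_collision_virial_jump:
  fixes t :: real
  assumes traj: "hs_trajectory \<epsilon> N \<gamma>" and "\<epsilon> > 0"
    and coll: "hs_collision \<epsilon> N \<gamma> t i j \<omega>"
    and lip: "\<And>x v v'. \<bar>\<phi> (t, x, v') - \<phi> (t, x, v)\<bar> \<le> L * norm (v' - v)"
    and cont: "continuous_on UNIV \<phi>"
  obtains l r l' r' where
    "((\<lambda>s. virial N s (\<gamma> s)) \<longlongrightarrow> l) (at_left t)" "((\<lambda>s. virial N s (\<gamma> s)) \<longlongrightarrow> r) (at_right t)"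
    "((\<lambda>s. \<Sum>i=1..N. \<phi> (s, \<gamma> s i)) \<longlongrightarrow> l') (at_left t)"
    "((\<lambda>s. \<Sum>i=1..N. \<phi> (s, \<gamma> s i)) \<longlongrightarrow> r') (at_right t)"
    "\<epsilon> * \<bar>r' - l'\<bar> \<le> 2 * L * (r - l)"
proof -
  define I where "I = {1..N}"
  define x where "x k = fst (\<gamma> t k)" for k
  have ij: "i \<in> I" "j \<in> I" "i < j" "norm \<omega> = 1" and contact: "x j = x i + \<epsilon> *\<^sub>R \<omega>"
    using coll unfolding hs_collision_def I_def x_def by auto
  obtain v v' where v: "\<And>k. k \<in> I \<Longrightarrow> ((\<lambda>s. snd (\<gamma> s k)) \<longlongrightarrow> v k) (at_left t)"
      "\<And>k. k \<in> I \<Longrightarrow> ((\<lambda>s. snd (\<gamma> s k)) \<longlongrightarrow> v' k) (at_right t)"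
    and vi: "v' i = v i + (\<omega> \<bullet> (v j - v i)) *\<^sub>R \<omega>"
    and vj: "v' j = v j - (\<omega> \<bullet> (v j - v i)) *\<^sub>R \<omega>"
    and vk: "\<And>k. k \<in> I - {i, j} \<Longrightarrow> v' k = v k"
    using coll unfolding hs_collision_def I_def by blast
  define c where "c = \<omega> \<bullet> (v j - v i)"
  have c: "c \<le> 0" unfolding c_def
    using hs_collision_incoming[OF traj \<open>\<epsilon> > 0\<close>, of i j \<omega> t "v i" "v j"] ij v contact
    unfolding I_def x_def by auto
  \<comment> \<open>An arbitrary set \<open>A\<close> lets one argument serve both one-sided
    limits.\<close>
  have xl: "((\<lambda>s. fst (\<gamma> s k)) \<longlongrightarrow> x k) (at t within A)" if "k \<in> I" for k A
  proof -
    have "continuous_on UNIV (\<lambda>s. fst (\<gamma> s k))"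
      using traj that unfolding hs_trajectory_def I_def by blast
    then have "((\<lambda>s. fst (\<gamma> s k)) \<longlongrightarrow> x k) (at t within UNIV)"
      unfolding continuous_on_def x_def by blast
    then show ?thesis by (rule tendsto_within_subset) simp
  qed
  have lim: "((\<lambda>s. virial N s (\<gamma> s)) \<longlongrightarrow> (\<Sum>k\<in>I. x k \<bullet> u k - (norm (u k))\<^sup>2 * t)) (at t within A)"
     "((\<lambda>s. \<Sum>i=1..N. \<phi> (s, \<gamma> s i)) \<longlongrightarrow> (\<Sum>k\<in>I. \<phi> (t, x k, u k))) (at t within A)"
    if u: "\<And>k. k \<in> I \<Longrightarrow> ((\<lambda>s. snd (\<gamma> s k)) \<longlongrightarrow> u k) (at t within A)" for u A
  proof -
    show "((\<lambda>s. virial N s (\<gamma> s)) \<longlongrightarrow> (\<Sum>k\<in>I. x k \<bullet> u k - (norm (u k))\<^sup>2 * t)) (at t within A)"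
      unfolding virial_def I_def[symmetric] by (intro tendsto_intros xl u)
    have "((\<lambda>s. \<phi> (s, fst (\<gamma> s k), snd (\<gamma> s k))) \<longlongrightarrow> \<phi> (t, x k, u k)) (at t within A)" if "k \<in> I" for k
      using that cont by (intro continuous_on_tendsto_compose[OF cont] tendsto_intros xl u) auto
    then show "((\<lambda>s. \<Sum>i=1..N. \<phi> (s, \<gamma> s i)) \<longlongrightarrow> (\<Sum>k\<in>I. \<phi> (t, x k, u k))) (at t within A)"
      unfolding I_def[symmetric] by (intro tendsto_sum) simp
  qed
  have "(\<Sum>k\<in>I. x k \<bullet> v' k - (norm (v' k))\<^sup>2 * t) - (\<Sum>k\<in>I. x k \<bullet> v k - (norm (v k))\<^sup>2 * t)
    = (\<Sum>k\<in>I. x k \<bullet> (v' k - v k) - (v' k \<bullet> v' k - v k \<bullet> v k) * t)"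
    by (simp add: sum_subtractf[symmetric] power2_norm_eq_inner algebra_simps)
  also have "\<dots> = (x i \<bullet> (v' i - v i) - (v' i \<bullet> v' i - v i \<bullet> v i) * t)
     + (x j \<bullet> (v' j - v j) - (v' j \<bullet> v' j - v j \<bullet> v j) * t)"
    using ij vk by (intro sum_eq_two) (auto simp: I_def)
  also have "\<dots> = - \<epsilon> * c"
  proof -
    have o: "\<omega> \<bullet> \<omega> = 1" using ij by (simp add: dot_square_norm)
    have s: "v' i = v i + c *\<^sub>R \<omega>" "v' j = v j - c *\<^sub>R \<omega>" using vi vj by (simp_all add: c_def)
    \<comment> \<open>Conservation of kinetic energy: \<omega> . (v_i - v_j) = - c, so the
      right-hand side is - 2 c^2 + 2 c^2. The terms with the explicit factor \<open>t\<close>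
      therefore cancel.\<close>
    have "v' i \<bullet> v' i - v i \<bullet> v i + (v' j \<bullet> v' j - v j \<bullet> v j) = 2 * c * (\<omega> \<bullet> (v i - v j)) + 2 * c * c"
      unfolding s by (simp add: inner_simps o inner_commute algebra_simps)
    also have "\<dots> = 0" unfolding c_def by (simp add: inner_simps algebra_simps)
    finally have e: "v' j \<bullet> v' j - v j \<bullet> v j = - (v' i \<bullet> v' i - v i \<bullet> v i)" by simp
    \<comment> \<open>Momentum is conserved, so the common position \<open>x i\<close> drops out and
      only the offset \<epsilon> \<omega> of the second centre contributes.\<close>
    have "x i \<bullet> (v' i - v i) + x j \<bullet> (v' j - v j) = - \<epsilon> * c"
      unfolding s contact by (simp add: inner_simps o algebra_simps)
    then show ?thesis unfolding e by (simp add: algebra_simps)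
  qed
  finally have q: "(\<Sum>k\<in>I. x k \<bullet> v' k - (norm (v' k))\<^sup>2 * t) - (\<Sum>k\<in>I. x k \<bullet> v k - (norm (v k))\<^sup>2 * t) = - \<epsilon> * c" .
  have "(\<Sum>k\<in>I. \<phi> (t, x k, v' k)) - (\<Sum>k\<in>I. \<phi> (t, x k, v k))
    = (\<Sum>k\<in>I. \<phi> (t, x k, v' k) - \<phi> (t, x k, v k))"
    by (simp add: sum_subtractf)
  also have "\<dots> = (\<phi> (t, x i, v' i) - \<phi> (t, x i, v i)) + (\<phi> (t, x j, v' j) - \<phi> (t, x j, v j))"
    using ij vk by (intro sum_eq_two) (auto simp: I_def)
  also have "\<bar>\<dots>\<bar> \<le> L * norm (v' i - v i) + L * norm (v' j - v j)"
    using lip[of "x i" "v' i" "v i"] lip[of "x j" "v' j" "v j"] by linarith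
  also have "\<dots> = 2 * L * - c"
    using ij c by (simp add: vi vj c_def[symmetric])
  finally have "\<epsilon> * \<bar>(\<Sum>k\<in>I. \<phi> (t, x k, v' k)) - (\<Sum>k\<in>I. \<phi> (t, x k, v k))\<bar> \<le> \<epsilon> * (2 * L * - c)"
    using \<open>\<epsilon> > 0\<close> by (intro mult_left_mono) auto
  then have "\<epsilon> * \<bar>(\<Sum>k\<in>I. \<phi> (t, x k, v' k)) - (\<Sum>k\<in>I. \<phi> (t, x k, v k))\<bar> \<le>
      2 * L * ((\<Sum>k\<in>I. x k \<bullet> v' k - (norm (v' k))\<^sup>2 * t) - (\<Sum>k\<in>I. x k \<bullet> v k - (norm (v k))\<^sup>2 * t))"
    unfolding q by (simp add: algebra_simps)
  then show thesis
    using that lim(1)[OF v(1)] lim(1)[OF v(2)] lim(2)[OF v(1)] lim(2)[OF v(2)] by blast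
qed

section \<open>Riemann sums and the transport bound along one trajectory\<close>

text \<open>The n-th sum is the integral of the step function \<open>u (p n t)\<close>, where
  \<open>p n t\<close> is the grid point to the left of \<open>t\<close>. Since \<open>p n t\<close>
  tends to \<open>t\<close>, dominated convergence yields both integrability of \<open>u\<close> and
  the limit.\<close>

lemma riemann_sums_tendsto:
  fixes u :: "real \<Rightarrow> real"
  assumes "a < b" and bound: "\<And>t. t \<in> {a..b} \<Longrightarrow> \<bar>u t\<bar> \<le> M"
    and S: "negligible S"
    and cont: "\<And>t. t \<in> {a..b} - S \<Longrightarrow> continuous (at t within {a..b}) u"
  shows "u integrable_on {a..b}"
    and "(\<lambda>n. (b - a) / real (Suc n) * (\<Sum>k\<le>n. u (a + real k * ((b - a) / real (Suc n)))))
      \<longlonglongrightarrow> integral {a..b} u"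
proof -
  define h where "h n = (b - a) / real (Suc n)" for n
  have h: "h n > 0" for n using \<open>a < b\<close> by (simp add: h_def)
  define p where "p n t = a + real_of_int \<lfloor>(t - a) / h n\<rfloor> * h n" for n t
  \<comment> \<open>\<open>dominated_convergence\<close> asks for convergence at every point of the
    domain, so the null set of possible discontinuities is cut out of it; the integrals do not
    notice.\<close>
  define A where "A = {a..<b} - S"
  have p_bounds: "p n t \<le> t" "t < p n t + h n" for n t
  proof -
    show "p n t \<le> t" "t < p n t + h n"
      using floor_divide_lower[OF h, of "t - a" n] floor_divide_upper[OF h, of "t - a" n]
      by (simp_all add: p_def distrib_right)
  qed
  have p_ge: "a \<le> p n t" if "a \<le> t" for n t
    using that h[of n] by (simp add: p_def)
  have step: "((\<lambda>t. u (p n t)) has_integral (\<Sum>k<m. h n * u (a + real k * h n))) {a..a + real m * h n}" for n m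
  proof (induction m)
    case (Suc m)
    let ?c = "a + real m * h n" and ?d = "a + real (Suc m) * h n"
    have "((\<lambda>t. u ?c) has_integral h n * u ?c) {?c..?d}"
      using has_integral_const_real[of "u ?c" ?c ?d] h[of n] by (simp add: algebra_simps)
    \<comment> \<open>At the right end of the cell the floor has already moved on to m + 1; this
      single point is ignored.\<close>
    then have "((\<lambda>t. u (p n t)) has_integral h n * u ?c) {?c..?d}"
    proof (rule has_integral_spike_finite[of "{?d}", rotated 2])
      fix t assume t: "t \<in> {?c..?d} - {?d}"
      then have "\<lfloor>(t - a) / h n\<rfloor> = int m"
        using h[of n] by (intro floor_unique) (auto simp: field_simps)
      then show "u (p n t) = u ?c" by (simp add: p_def)
    qed auto
    from has_integral_combine[OF _ _ Suc.IH this] show ?case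
      using h[of n] by (simp add: algebra_simps)
  qed (simp add: has_integral_refl)
  have end_eq: "a + real (Suc n) * h n = b" for n by (simp add: h_def)
  have neg: "negligible {x \<in> {a..b} - A. w x \<noteq> 0}" "negligible {x \<in> A - {a..b}. w x \<noteq> 0}" for w :: "real \<Rightarrow> real"
    by (rule negligible_subset[of "S \<union> {b}"], use S in \<open>auto simp: A_def\<close>)+
  have iA: "(w has_integral I) A \<longleftrightarrow> (w has_integral I) {a..b}" for w :: "real \<Rightarrow> real" and I
    by (intro has_integral_spike_set_eq neg)
  have sA: "((\<lambda>t. u (p n t)) has_integral (\<Sum>k<Suc n. h n * u (a + real k * h n))) A" for n
    using step[of n "Suc n"] unfolding iA end_eq .
  have "(\<lambda>t. M) integrable_on A"
    using iA[of "\<lambda>t. M"] integrable_const_ivl[of M a b] unfolding integrable_on_def by simp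
  moreover have "norm (u (p n t)) \<le> M" if "t \<in> A" for n t
    using bound[of "p n t"] p_ge[of t n] p_bounds(1)[of n t] that by (auto simp: A_def)
  moreover have "(\<lambda>n. u (p n t)) \<longlonglongrightarrow> u t" if "t \<in> A" for t
  proof -
    have "h \<longlonglongrightarrow> 0"
      unfolding h_def using tendsto_mult_right_zero[OF LIMSEQ_inverse_real_of_nat, of "b - a"]
      by (simp add: divide_inverse)
    then have "(\<lambda>n. t - h n) \<longlonglongrightarrow> t" by (auto intro!: tendsto_eq_intros)
    then have "(\<lambda>n. p n t) \<longlonglongrightarrow> t"
    proof (rule tendsto_sandwich[rotated 2])
      show "\<forall>\<^sub>F n in sequentially. t - h n \<le> p n t"
        using p_bounds(2)[of t] by (intro always_eventually allI) (smt (verit))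
      show "\<forall>\<^sub>F n in sequentially. p n t \<le> t" using p_bounds(1) by simp
    qed simp
    moreover have "continuous (at t within {a..b}) u"
      using cont[of t] that by (auto simp: A_def)
    moreover have "p n t \<in> {a..b}" for n
      using p_ge[of t n] p_bounds(1)[of n t] that by (auto simp: A_def)
    ultimately show ?thesis
      unfolding continuous_within_sequentially o_def by auto
  qed
  ultimately have "u integrable_on A" "(\<lambda>n. integral A (\<lambda>t. u (p n t))) \<longlonglongrightarrow> integral A u"
    using dominated_convergence[of "\<lambda>n t. u (p n t)" A "\<lambda>t. M" u] sA by blast+
  moreover have "integral A (\<lambda>t. u (p n t)) = h n * (\<Sum>k\<le>n. u (a + real k * h n))" for n
    using integral_unique[OF sA[of n]] by (simp add: sum_distrib_left lessThan_Suc_atMost)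
  moreover from \<open>u integrable_on A\<close> have "(u has_integral integral A u) {a..b}"
    unfolding iA[symmetric] by (rule integrable_integral)
  ultimately show "u integrable_on {a..b}"
    "(\<lambda>n. (b - a) / real (Suc n) * (\<Sum>k\<le>n. u (a + real k * ((b - a) / real (Suc n))))) \<longlonglongrightarrow> integral {a..b} u"
    unfolding h_def[symmetric] by (auto simp: integral_unique)
qed

lemma hs_trajectory_isCont:
  fixes \<gamma> :: "real \<Rightarrow> 'a::euclidean_space config" and g :: "real \<times> 'a \<times> 'a \<Rightarrow> real"
  assumes traj: "hs_trajectory \<epsilon> N \<gamma>" and D: "\<gamma> t \<in> hs_domain \<epsilon> N"
    and cont: "continuous_on UNIV g"
  shows "isCont (\<lambda>s. \<Sum>i=1..N. g (s, \<gamma> s i)) t"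
proof (rule isCont_sum, rule ballI)
  fix i assume i: "i \<in> {1..N}"
  have "isCont (\<lambda>s. fst (\<gamma> s i)) t" "isCont (\<lambda>s. snd (\<gamma> s i)) t"
    using traj D i unfolding hs_trajectory_def by (blast intro: has_vector_derivative_continuous)+
  then have "isCont (\<lambda>s. (s, fst (\<gamma> s i), snd (\<gamma> s i))) t"
    by (intro continuous_Pair continuous_ident)
  then have "isCont (\<lambda>s. (s, \<gamma> s i)) t" by simp
  moreover have "isCont g (t, \<gamma> t i)"
    using cont unfolding continuous_on_eq_continuous_at[OF open_UNIV] by blast
  ultimately show "isCont (\<lambda>s. g (s, \<gamma> s i)) t"
    by (rule isCont_o2)
qed

text \<open>Let J be the running time integral of the transport derivative. Between collisions
  \<Phi> and J have the same derivative and the virial V is constant; at a collision the increase of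
  2 L V dominates the jump of \<epsilon> \<Phi>. Hence 2 L V + \<epsilon> (\<Phi> - J) and 2 L V -
  \<epsilon> (\<Phi> - J) are both monotone in the sense of \<open>jump_mono\<close>, and together
  they give the absolute value.\<close>

lemma hs_trajectory_transport_bound:
  fixes \<gamma> :: "real \<Rightarrow> 'a::euclidean_space config"
  assumes traj: "hs_trajectory \<epsilon> N \<gamma>" and "\<epsilon> > 0" "a < b"
    and ends: "\<gamma> a \<in> hs_domain \<epsilon> N" "\<gamma> b \<in> hs_domain \<epsilon> N"
    and C1: "Ck (Suc 0) \<phi>"
    and lip: "\<And>t x v v'. \<bar>\<phi> (t, x, v') - \<phi> (t, x, v)\<bar> \<le> L * norm (v' - v)"
    and u: "(\<lambda>s. \<Sum>i=1..N. transport_derivative \<phi> (s, \<gamma> s i)) integrable_on {a..b}"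
  shows "\<epsilon> * \<bar>(\<Sum>i=1..N. \<phi> (b, \<gamma> b i)) - (\<Sum>i=1..N. \<phi> (a, \<gamma> a i))
      - integral {a..b} (\<lambda>s. \<Sum>i=1..N. transport_derivative \<phi> (s, \<gamma> s i))\<bar>
    \<le> 2 * L * (virial N b (\<gamma> b) - virial N a (\<gamma> a))"
proof -
  define u where "u s = (\<Sum>i=1..N. transport_derivative \<phi> (s, \<gamma> s i))" for s
  define \<Phi> where "\<Phi> s = (\<Sum>i=1..N. \<phi> (s, \<gamma> s i))" for s
  define V where "V s = virial N s (\<gamma> s)" for s
  define J where "J s = integral {a..s} u" for s
  define S where "S = {t \<in> {a..b}. \<gamma> t \<notin> hs_domain \<epsilon> N}"
  \<comment> \<open>Since \<open>a\<close> and \<open>b\<close> are not collision times, every jump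
    lies in the open interval and both of its one-sided limits are seen.\<close>
  have S: "finite S" "S \<subseteq> {a<..<b}"
    using traj ends unfolding S_def hs_trajectory_def by (auto simp: order_less_le)
  have int: "u integrable_on {a..b}" using u by (simp add: u_def[abs_def])
  have contD: "continuous_on UNIV (transport_derivative \<phi>)"
    using Ck_transport_derivative[OF C1] by simp
  have cont: "continuous_on UNIV \<phi>" using Ck_Suc_imp_Ck[OF C1] by simp
  have derJ: "(J has_real_derivative u t) (at t within {a..b})" if "t \<in> {a..b} - S" for t
  proof -
    have "isCont u t" unfolding u_def
      using that by (intro hs_trajectory_isCont[OF traj _ contD]) (auto simp: S_def)
    then have "continuous (at t within {a..b} - {}) u"
      by (rule continuous_at_imp_continuous_at_within)
    then show ?thesis
      using integral_has_vector_derivative_continuous_at[OF int, of t "{}"] that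
      by (simp add: J_def[abs_def] has_real_derivative_iff_has_vector_derivative)
  qed
  have der\<Phi>: "(\<Phi> has_real_derivative u t) (at t within {a..b})" if "t \<in> {a..b} - S" for t
  proof -
    have D: "\<gamma> t \<in> hs_domain \<epsilon> N" using that by (auto simp: S_def)
    have "((\<lambda>s. \<phi> (s, \<gamma> s i)) has_real_derivative transport_derivative \<phi> (t, \<gamma> t i)) (at t)"
      if i: "i \<in> {1..N}" for i
    proof -
      have "\<phi> differentiable (at (t, fst (\<gamma> t i), snd (\<gamma> t i)))"
        using C1 unfolding Ck.simps by blast
      moreover have "((\<lambda>s. fst (\<gamma> s i)) has_vector_derivative snd (\<gamma> t i)) (at t)"
        "((\<lambda>s. snd (\<gamma> s i)) has_vector_derivative 0) (at t)"
        using traj D i unfolding hs_trajectory_def by blast+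
      ultimately show ?thesis
        using has_real_derivative_along_curve[of \<phi> t "\<lambda>s. fst (\<gamma> s i)" "\<lambda>s. snd (\<gamma> s i)"]
        by (simp add: transport_derivative_def)
    qed
    then have "(\<Phi> has_real_derivative u t) (at t)"
      unfolding \<Phi>_def u_def by (intro DERIV_sum) auto
    then show ?thesis by (rule has_field_derivative_at_within)
  qed
  have derV: "(V has_real_derivative 0) (at t within {a..b})" if "t \<in> {a..b} - S" for t
  proof -
    have D: "\<gamma> t \<in> hs_domain \<epsilon> N" using that by (auto simp: S_def)
    have "((\<lambda>s. fst (\<gamma> s i) \<bullet> snd (\<gamma> s i) - (norm (snd (\<gamma> s i)))\<^sup>2 * s) has_real_derivative 0) (at t)"
      if i: "i \<in> {1..N}" for i
    proof -
      have d: "((\<lambda>s. fst (\<gamma> s i)) has_derivative (\<lambda>h. h *\<^sub>R snd (\<gamma> t i))) (at t)"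
        "((\<lambda>s. snd (\<gamma> s i)) has_derivative (\<lambda>h. 0)) (at t)"
        using traj D i unfolding hs_trajectory_def has_vector_derivative_def by auto
      show ?thesis
        unfolding has_field_derivative_def power2_norm_eq_inner
        by (rule derivative_eq_intros d | rule refl)+ (auto simp: algebra_simps)
    qed
    then have "(V has_real_derivative (\<Sum>i=1..N. 0)) (at t)"
      unfolding V_def virial_def by (intro DERIV_sum) auto
    then show ?thesis by (simp add: has_field_derivative_at_within)
  qed
  have main: "2 * L * V a + \<sigma> * (\<epsilon> * (\<Phi> a - J a)) \<le> 2 * L * V b + \<sigma> * (\<epsilon> * (\<Phi> b - J b))"
    if \<sigma>: "\<sigma> = 1 \<or> \<sigma> = -1" for \<sigma> :: real
  proof (rule jump_mono[OF S \<open>a < b\<close>, of "\<lambda>s. 2 * L * V s + \<sigma> * (\<epsilon> * (\<Phi> s - J s))"])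
    fix t assume t: "t \<in> {a..b} - S"
    show "((\<lambda>s. 2 * L * V s + \<sigma> * (\<epsilon> * (\<Phi> s - J s))) has_real_derivative 0) (at t within {a..b})"
      by (rule derivative_eq_intros derV[OF t] derJ[OF t] der\<Phi>[OF t] | rule refl)+ simp
  next
    fix t assume t: "t \<in> S"
    then obtain i j \<omega> where coll: "hs_collision \<epsilon> N \<gamma> t i j \<omega>"
      using traj unfolding hs_trajectory_def S_def by blast
    obtain l r l' r' where lim:
        "(V \<longlongrightarrow> l) (at_left t)" "(V \<longlongrightarrow> r) (at_right t)"
        "(\<Phi> \<longlongrightarrow> l') (at_left t)" "(\<Phi> \<longlongrightarrow> r') (at_right t)"
        "\<epsilon> * \<bar>r' - l'\<bar> \<le> 2 * L * (r - l)"
      unfolding V_def[abs_def] \<Phi>_def[abs_def]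
      using hs_collision_virial_jump[OF traj \<open>\<epsilon> > 0\<close> coll lip cont] by blast
    \<comment> \<open>Although the integrand may jump at the collision, its indefinite integral is
      continuous, so \<open>J\<close> does not contribute to the jump.\<close>
    have "isCont J t"
    proof -
      have "continuous_on {a..b} J"
        unfolding J_def using int by (rule indefinite_integral_continuous_1)
      then show ?thesis
        using t S(2) by (intro continuous_on_interior[of "{a..b}"]) auto
    qed
    then have J: "(J \<longlongrightarrow> J t) (at_left t)" "(J \<longlongrightarrow> J t) (at_right t)"
      by (auto simp: isCont_def filterlim_at_split)
    have "\<sigma> * (\<epsilon> * (l' - r')) \<le> 2 * L * (r - l)"
    proof -
      have "\<sigma> * (\<epsilon> * (l' - r')) \<le> \<bar>\<sigma> * (\<epsilon> * (l' - r'))\<bar>" by simp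
      also have "\<dots> = \<epsilon> * \<bar>r' - l'\<bar>" using \<sigma> \<open>\<epsilon> > 0\<close> by (auto simp: abs_mult)
      finally show ?thesis using lim(5) by simp
    qed
    then have "2 * L * l + \<sigma> * (\<epsilon> * (l' - J t)) \<le> 2 * L * r + \<sigma> * (\<epsilon> * (r' - J t))"
      by (simp add: algebra_simps)
    moreover have
      "((\<lambda>s. 2 * L * V s + \<sigma> * (\<epsilon> * (\<Phi> s - J s))) \<longlongrightarrow> 2 * L * l + \<sigma> * (\<epsilon> * (l' - J t))) (at_left t)"
      "((\<lambda>s. 2 * L * V s + \<sigma> * (\<epsilon> * (\<Phi> s - J s))) \<longlongrightarrow> 2 * L * r + \<sigma> * (\<epsilon> * (r' - J t))) (at_right t)"
      by (intro tendsto_intros lim J)+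
    ultimately show "\<exists>l r. ((\<lambda>s. 2 * L * V s + \<sigma> * (\<epsilon> * (\<Phi> s - J s))) \<longlongrightarrow> l) (at_left t) \<and>
        ((\<lambda>s. 2 * L * V s + \<sigma> * (\<epsilon> * (\<Phi> s - J s))) \<longlongrightarrow> r) (at_right t) \<and> l \<le> r"
      by blast
  qed
  have "J a = 0" by (simp add: J_def)
  then have "\<bar>\<epsilon> * (\<Phi> b - \<Phi> a - J b)\<bar> \<le> 2 * L * (V b - V a)"
    using main[of 1] main[of "-1"] by (simp add: abs_le_iff algebra_simps)
  then show ?thesis
    using \<open>\<epsilon> > 0\<close> by (simp add: abs_mult \<Phi>_def J_def V_def u_def[abs_def])
qed

section \<open>The measure on hard sphere configurations\<close>

text \<open>The preimages under \<open>f\<close> and \<open>g\<close> differ by null sets, and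
  completeness makes such a change harmless. This is what allows measurability to be read off from
  almost everywhere representatives.\<close>

lemma (in complete_measure) borel_measurable_cong_AE:
  fixes f g :: "'a \<Rightarrow> 'b::topological_space"
  assumes f: "f \<in> borel_measurable M" and eq: "AE x in M. f x = g x"
  shows "g \<in> borel_measurable M"
proof (rule measurableI)
  fix A :: "'b set" assume "A \<in> sets borel"
  then have A: "f -` A \<inter> space M \<in> sets M" using f by (rule measurable_sets[rotated])
  have "AE x in M. x \<in> f -` A \<inter> space M \<longleftrightarrow> x \<in> g -` A \<inter> space M"
    using eq by eventually_elim auto
  from in_sets_AE[OF this A] show "g -` A \<inter> space M \<in> sets M"
    by blast
qed simp

lemma complete_measure_restrict_space:
  assumes "complete_measure M" "\<Omega> \<in> sets M"
  shows "complete_measure (restrict_space M \<Omega>)"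
proof
  fix A B assume "B \<subseteq> A" "A \<in> null_sets (restrict_space M \<Omega>)"
  then have "A \<in> null_sets M" "A \<subseteq> \<Omega>" using assms(2) by (auto simp: null_sets_restrict_space)
  then show "B \<in> sets (restrict_space M \<Omega>)"
    using complete_measure.complete[OF assms(1) \<open>B \<subseteq> A\<close>] \<open>B \<subseteq> A\<close> assms(2)
    by (auto simp: sets_restrict_space_iff)
qed

text \<open>The product before completion: Tonelli's theorem and the permutation of coordinates are
  used here, and the results are carried over to \<open>config_lebesgue\<close> by almost everywhere
  equality.\<close>

abbreviation config_lborel :: "'i set \<Rightarrow> ('i \<Rightarrow> 'b::euclidean_space) measure" where
  "config_lborel I \<equiv> PiM I (\<lambda>_. lborel)"

interpretation lborel_product: product_sigma_finite "\<lambda>_::'i. lborel :: 'b::euclidean_space measure"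
  by (simp add: product_sigma_finite_def sigma_finite_lborel)

text \<open>A product measure is determined by boxes. The preimage of a box is the box with permuted
  sides, and its volume is the same product in another order.\<close>

lemma distr_lborel_product_permute:
  fixes I :: "'i set"
  assumes "finite I" "\<sigma> permutes I"
  defines "P \<equiv> PiM I (\<lambda>_. lborel :: 'b::euclidean_space measure)"
  shows "(\<lambda>Z. Z \<circ> \<sigma>) \<in> P \<rightarrow>\<^sub>M P" "distr P P (\<lambda>Z. Z \<circ> \<sigma>) = P"
proof -
  show m: "(\<lambda>Z. Z \<circ> \<sigma>) \<in> P \<rightarrow>\<^sub>M P"
    unfolding P_def o_def
  proof (rule measurable_PiM_single')
    fix i assume "i \<in> I"
    then have "\<sigma> i \<in> I" using assms(2) by (simp add: permutes_in_image)
    then show "(\<lambda>Z. Z (\<sigma> i)) \<in> PiM I (\<lambda>_. lborel :: 'b measure) \<rightarrow>\<^sub>M lborel"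
      by (rule measurable_component_singleton)
  next
    show "(\<lambda>Z i. Z (\<sigma> i)) \<in> space (PiM I (\<lambda>_. lborel :: 'b measure)) \<rightarrow> (\<Pi>\<^sub>E i\<in>I. space lborel)"
      using assms(2) by (auto simp: space_PiM PiE_def extensional_def permutes_not_in)
  qed
  show "distr P P (\<lambda>Z. Z \<circ> \<sigma>) = P"
    unfolding P_def
  proof (rule lborel_product.PiM_eqI)
    fix A :: "'i \<Rightarrow> 'b set" assume A: "\<And>i. i \<in> I \<Longrightarrow> A i \<in> sets lborel"
    have im: "\<sigma> i \<in> I \<longleftrightarrow> i \<in> I" "inv \<sigma> i \<in> I \<longleftrightarrow> i \<in> I" for i
      using assms(2) permutes_inv[OF assms(2)] by (simp_all add: permutes_in_image)
    have pre: "(\<lambda>Z. Z \<circ> \<sigma>) -` (PiE I A) \<inter> space P = PiE I (\<lambda>i. A (inv \<sigma> i))"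
      using assms(2) im permutes_inverses[OF assms(2)]
      by (auto simp: P_def space_PiM PiE_iff extensional_def permutes_not_in) (metis+)
    have "emeasure (distr P P (\<lambda>Z. Z \<circ> \<sigma>)) (PiE I A) = emeasure P (PiE I (\<lambda>i. A (inv \<sigma> i)))"
    proof -
      have "PiE I A \<in> sets P" unfolding P_def using A assms(1) by (intro sets_PiM_I_finite)
      then show ?thesis by (simp only: emeasure_distr[OF m] pre)
    qed
    also have "\<dots> = (\<Prod>i\<in>I. emeasure lborel (A (inv \<sigma> i)))"
      unfolding P_def using A assms(1) im by (intro lborel_product.emeasure_PiM) auto
    also have "\<dots> = (\<Prod>i\<in>I. emeasure lborel (A i))"
      using prod.permute[OF permutes_inv[OF assms(2)], of "\<lambda>i. emeasure lborel (A i)"]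
      by (simp add: o_def)
    finally show "emeasure (distr (PiM I (\<lambda>_. lborel)) (PiM I (\<lambda>_. lborel)) (\<lambda>Z. Z \<circ> \<sigma>)) (PiE I A)
      = (\<Prod>i\<in>I. emeasure lborel (A i))"
      unfolding P_def .
  qed (use assms(1) in simp_all)
qed

lemma hs_domain_sets:
  "hs_domain \<epsilon> N \<in> sets (PiM {1..N} (\<lambda>_. lborel :: ('a \<times> 'a::euclidean_space) measure))"
proof -
  have "{Z \<in> space (PiM {1..N} (\<lambda>_. lborel :: ('a \<times> 'a) measure)).
      \<forall>i\<in>{1..N}. \<forall>j\<in>{1..N}. i < j \<longrightarrow> norm (fst (Z i) - fst (Z j)) > \<epsilon>}
    \<in> sets (PiM {1..N} (\<lambda>_. lborel))"
  proof (intro sets.sets_Collect_finite_All sets.sets_Collect_imp sets.sets_Collect_const)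
    fix i j assume ij: "i \<in> {1..N}" "j \<in> {1..N}"
    have c: "(\<lambda>Z. Z k) \<in> PiM {1..N} (\<lambda>_. lborel :: ('a \<times> 'a) measure) \<rightarrow>\<^sub>M borel" if "k \<in> {1..N}" for k
      using measurable_component_singleton[OF that, of "\<lambda>_. lborel :: ('a \<times> 'a) measure"] by simp
    have f: "fst \<in> borel_measurable (borel :: ('a \<times> 'a) measure)"
      by (intro borel_measurable_continuous_onI continuous_intros)
    note [measurable] = measurable_compose[OF c[OF ij(1)] f] measurable_compose[OF c[OF ij(2)] f]
    show "{Z \<in> space (PiM {1..N} (\<lambda>_. lborel :: ('a \<times> 'a) measure)). \<epsilon> < norm (fst (Z i) - fst (Z j))}
      \<in> sets (PiM {1..N} (\<lambda>_. lborel))"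
      by measurable
  qed auto
  then show ?thesis by (simp only: hs_domain_def space_PiM space_lborel space_borel)
qed

lemma hs_measure_facts:
  fixes N :: nat and \<epsilon> :: real and Q :: "'a::euclidean_space config \<Rightarrow> bool"
    and h :: "'a config \<Rightarrow> ennreal" and f :: "'a config \<Rightarrow> 'c"
  shows space_hs_measure: "space (hs_measure \<epsilon> N) = (hs_domain \<epsilon> N :: 'a config set)"
    and complete_hs_measure: "complete_measure (hs_measure \<epsilon> N :: 'a config measure)"
    and AE_hs_measure: "(AE Z in hs_measure \<epsilon> N. Q Z) \<longleftrightarrow> (AE Z in config_lborel {1..N}. Z \<in> hs_domain \<epsilon> N \<longrightarrow> Q Z)"
    and nn_integral_hs_measure:
      "(\<integral>\<^sup>+ Z. h Z \<partial>hs_measure \<epsilon> N) = (\<integral>\<^sup>+ Z. h Z * indicator (hs_domain \<epsilon> N) Z \<partial>config_lborel {1..N})"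
    and measurable_hs_measureI: "f \<in> config_lborel {1..N} \<rightarrow>\<^sub>M M \<Longrightarrow> f \<in> hs_measure \<epsilon> N \<rightarrow>\<^sub>M M"
proof -
  define P where "P = (config_lborel {1..N} :: 'a config measure)"
  have D: "hs_domain \<epsilon> N \<in> sets (completion P)"
    using hs_domain_sets[of \<epsilon> N, where 'a='a] by (simp add: P_def)
  have sub: "hs_domain \<epsilon> N \<subseteq> space P" using hs_domain_sets[of \<epsilon> N, where 'a='a] sets.sets_into_space unfolding P_def by blast
  then have D': "hs_domain \<epsilon> N \<inter> space (completion P) \<in> sets (completion P)"
    using D by (simp add: Int_absorb2)
  note m = hs_measure_def config_lebesgue_def P_def[symmetric]
  show "space (hs_measure \<epsilon> N) = (hs_domain \<epsilon> N :: 'a config set)"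
    using sub unfolding m by (simp add: space_restrict_space Int_absorb2)
  show "complete_measure (hs_measure \<epsilon> N :: 'a config measure)"
    unfolding m using D by (intro complete_measure_restrict_space completion.complete_measure_axioms)
  show "(AE Z in hs_measure \<epsilon> N. Q Z) \<longleftrightarrow> (AE Z in config_lborel {1..N}. Z \<in> hs_domain \<epsilon> N \<longrightarrow> Q Z)"
    unfolding m by (simp only: AE_restrict_space_iff[OF D'] AE_completion_iff)
  show "(\<integral>\<^sup>+ Z. h Z \<partial>hs_measure \<epsilon> N) = (\<integral>\<^sup>+ Z. h Z * indicator (hs_domain \<epsilon> N) Z \<partial>config_lborel {1..N})"
    unfolding m by (simp only: nn_integral_restrict_space[OF D'] nn_integral_completion)
  show "f \<in> hs_measure \<epsilon> N \<rightarrow>\<^sub>M M" if "f \<in> config_lborel {1..N} \<rightarrow>\<^sub>M M"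
    using that unfolding m by (intro measurable_restrict_space1 measurable_completion)
qed

section \<open>Densities, their Borel representatives and the first marginal\<close>

text \<open>A density is measurable for the completed measure only, and its slices with one particle
  fixed need not be measurable. The representative is measurable for the plain product, non-negative
  everywhere, and already contains the extension by zero.\<close>

lemma hs_density_borel_version:
  fixes g :: "'a::euclidean_space config \<Rightarrow> real"
  assumes g: "g \<in> borel_measurable (hs_measure \<epsilon> N)" and nn: "AE Z in hs_measure \<epsilon> N. 0 \<le> g Z"
  obtains g' where "g' \<in> borel_measurable (config_lborel {1..N})" "\<And>Z. 0 \<le> g' Z"
    "AE Z in config_lborel {1..N}. indicat_real (hs_domain \<epsilon> N) Z * g Z = g' Z"
    "\<And>h. h \<in> borel_measurable (config_lborel {1..N}) \<Longrightarrow>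
      (\<integral>\<^sup>+ Z. h Z * ennreal (g Z) \<partial>hs_measure \<epsilon> N) = (\<integral>\<^sup>+ Z. h Z * ennreal (g' Z) \<partial>config_lborel {1..N})"
proof -
  define P where "P = (config_lborel {1..N} :: 'a config measure)"
  have D: "hs_domain \<epsilon> N \<in> sets P" using hs_domain_sets unfolding P_def .
  then have D': "hs_domain \<epsilon> N \<inter> space (completion P) \<in> sets (completion P)"
    by auto
  have "(\<lambda>Z. indicat_real (hs_domain \<epsilon> N) Z * g Z) \<in> borel_measurable (completion P)"
    using g borel_measurable_restrict_space_iff[OF D', of g]
    by (simp add: hs_measure_def config_lebesgue_def P_def)
  from completion_ex_borel_measurable_real[OF this] obtain g1 where
    g1: "g1 \<in> borel_measurable P" "AE Z in P. indicat_real (hs_domain \<epsilon> N) Z * g Z = g1 Z" by blast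
  define g' where "g' Z = max 0 (g1 Z)" for Z
  have m: "g' \<in> borel_measurable P" using g1(1) unfolding g'_def by measurable
  have "AE Z in P. Z \<in> hs_domain \<epsilon> N \<longrightarrow> 0 \<le> g Z"
    using nn unfolding AE_hs_measure P_def .
  with g1(2) have ae: "AE Z in P. indicat_real (hs_domain \<epsilon> N) Z * g Z = g' Z"
  proof eventually_elim
    fix Z assume "indicat_real (hs_domain \<epsilon> N) Z * g Z = g1 Z" "Z \<in> hs_domain \<epsilon> N \<longrightarrow> 0 \<le> g Z"
    then show "indicat_real (hs_domain \<epsilon> N) Z * g Z = g' Z"
      by (cases "Z \<in> hs_domain \<epsilon> N") (auto simp: g'_def)
  qed
  show thesis
  proof (rule that[OF m[unfolded P_def] _ ae[unfolded P_def]])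
    fix h :: "'a config \<Rightarrow> ennreal"
    have "(\<integral>\<^sup>+ Z. h Z * ennreal (g Z) \<partial>hs_measure \<epsilon> N)
      = (\<integral>\<^sup>+ Z. h Z * ennreal (g Z) * indicator (hs_domain \<epsilon> N) Z \<partial>P)"
      unfolding nn_integral_hs_measure P_def ..
    also have "\<dots> = (\<integral>\<^sup>+ Z. h Z * ennreal (g' Z) \<partial>P)"
      by (rule nn_integral_cong_AE, use ae in eventually_elim)
        (auto simp: indicator_def split: if_splits)
    finally show "(\<integral>\<^sup>+ Z. h Z * ennreal (g Z) \<partial>hs_measure \<epsilon> N) = (\<integral>\<^sup>+ Z. h Z * ennreal (g' Z) \<partial>config_lborel {1..N})"
      unfolding P_def .
  qed (simp add: g'_def)
qed

text \<open>Tonelli's theorem, splitting off particle 1, for the Borel representative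
  \<open>g'\<close> of the density. The Bochner integral in \<open>first_marginal\<close> agrees
  with the marginal \<open>m\<close> of \<open>g'\<close> for almost every z only, so the
  measurability obtained is Lebesgue, not Borel.\<close>

lemma first_marginal_nn_integral:
  fixes g :: "'a::euclidean_space config \<Rightarrow> real"
  assumes "N \<ge> 1" and pd: "probability_density (hs_measure \<epsilon> N) g"
  shows borel_measurable_first_marginal: "first_marginal \<epsilon> N g \<in> borel_measurable lebesgue"
    and AE_first_marginal_nonneg: "AE z in lebesgue. 0 \<le> first_marginal \<epsilon> N g z"
    and nn_integral_first_marginal: "h \<in> borel_measurable borel \<Longrightarrow>
      (\<integral>\<^sup>+ z. h z * ennreal (first_marginal \<epsilon> N g z) \<partial>lebesgue)
        = (\<integral>\<^sup>+ Z. h (Z 1) * ennreal (g Z) \<partial>hs_measure \<epsilon> N)"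
proof -
  define P where "P = (config_lborel {1..N} :: 'a config measure)"
  define P' where "P' = (config_lborel {2..N} :: 'a config measure)"
  have ins: "{1..N} = insert 1 {2..N}" using \<open>N \<ge> 1\<close> by auto
  have g: "g \<in> borel_measurable (hs_measure \<epsilon> N)" "AE Z in hs_measure \<epsilon> N. 0 \<le> g Z"
    and one: "(\<integral>\<^sup>+ Z. ennreal (g Z) \<partial>hs_measure \<epsilon> N) = 1"
    using pd by (auto simp: probability_density_def)
  obtain g' where g'[measurable]: "g' \<in> borel_measurable P" and nn: "\<And>Z. 0 \<le> g' Z"
    and ae: "AE Z in P. indicat_real (hs_domain \<epsilon> N) Z * g Z = g' Z"
    and eq: "\<And>h. h \<in> borel_measurable P \<Longrightarrow>
      (\<integral>\<^sup>+ Z. h Z * ennreal (g Z) \<partial>hs_measure \<epsilon> N) = (\<integral>\<^sup>+ Z. h Z * ennreal (g' Z) \<partial>P)"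
    by (rule hs_density_borel_version[OF g, folded P_def]) (rule that)
  interpret P': sigma_finite_measure P'
    unfolding P'_def by (rule lborel_product.sigma_finite) simp
  have upd2[measurable]: "(\<lambda>p. (snd p)(1 := fst p)) \<in> lborel \<Otimes>\<^sub>M P' \<rightarrow>\<^sub>M P"
    unfolding P_def P'_def ins by (rule measurable_fun_upd[where J = "{2..N}"]) auto
  have upd[measurable]: "(\<lambda>W. W(1 := z)) \<in> P' \<rightarrow>\<^sub>M P" for z
    using measurable_compose[OF measurable_Pair1'[of z lborel P'] upd2] by simp
  have slice: "(\<integral>\<^sup>+ Z. w Z \<partial>P) = (\<integral>\<^sup>+ z. (\<integral>\<^sup>+ W. w (W(1 := z)) \<partial>P') \<partial>lborel)"
    if "w \<in> borel_measurable P" for w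
    using that unfolding P_def P'_def ins
    by (intro lborel_product.product_nn_integral_insert_rev) auto
  define m where "m z = (\<integral>\<^sup>+ W. ennreal (g' (W(1 := z))) \<partial>P')" for z
  have m[measurable]: "m \<in> borel_measurable lborel"
  proof -
    have "(\<lambda>p. ennreal (g' ((snd p)(1 := fst p)))) \<in> borel_measurable (lborel \<Otimes>\<^sub>M P')"
      by measurable
    then show ?thesis
      using P'.borel_measurable_nn_integral[of "\<lambda>z W. ennreal (g' (W(1 := z)))" lborel]
      unfolding m_def[abs_def] by (simp add: case_prod_beta')
  qed
  have "(\<integral>\<^sup>+ z. m z \<partial>lborel) = 1"
    using eq[of "\<lambda>_. 1"] one slice[of "\<lambda>Z. ennreal (g' Z)"] by (simp add: m_def[abs_def])
  \<comment> \<open>The total mass 1 makes \<open>m\<close> finite almost everywhere;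
    \<open>enn2real\<close> sends infinity to 0 and would otherwise lose mass.\<close>
  then have fin: "AE z in lborel. m z < \<infinity>"
    using nn_integral_PInf_AE[OF m] by (auto simp: less_top)
  have "AE z in lborel. AE W in P'. indicat_real (hs_domain \<epsilon> N) (W(1 := z)) * g (W(1 := z)) = g' (W(1 := z))"
  proof -
    \<comment> \<open>The set where \<open>g\<close> and \<open>g'\<close> disagree need not be
      measurable for the plain product. It is enclosed in a measurable null set, whose slices are
      null for almost every z by Tonelli.\<close>
    obtain Nl where Nl: "Nl \<in> null_sets P"
      "{Z \<in> space P. \<not> (indicat_real (hs_domain \<epsilon> N) Z * g Z = g' Z)} \<subseteq> Nl"
      using ae by (auto elim!: AE_E intro: null_setsI)
    then have [measurable]: "Nl \<in> sets P" by auto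
    have "(\<integral>\<^sup>+ z. (\<integral>\<^sup>+ W. indicator Nl (W(1 := z)) \<partial>P') \<partial>lborel) = 0"
      using slice[of "indicator Nl"] Nl(1) by (auto simp: null_setsD1)
    moreover have "(\<lambda>z. \<integral>\<^sup>+ W. indicator Nl (W(1 := z)) \<partial>P') \<in> borel_measurable lborel"
    proof -
      have "(\<lambda>p. indicator Nl ((snd p)(1 := fst p)) :: ennreal) \<in> borel_measurable (lborel \<Otimes>\<^sub>M P')"
        by measurable
      then show ?thesis
        using P'.borel_measurable_nn_integral[of "\<lambda>z W. indicator Nl (W(1 := z))" lborel]
        by (simp add: case_prod_beta')
    qed
    ultimately have "AE z in lborel. (\<integral>\<^sup>+ W. indicator Nl (W(1 := z)) \<partial>P') = 0"
      by (simp add: nn_integral_0_iff_AE)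
    then show ?thesis
    proof eventually_elim
      fix z assume "(\<integral>\<^sup>+ W. indicator Nl (W(1 := z)) \<partial>P') = 0"
      moreover have "(\<lambda>W. indicator Nl (W(1 := z)) :: ennreal) \<in> borel_measurable P'" by measurable
      ultimately have "AE W in P'. (indicator Nl (W(1 := z)) :: ennreal) = 0"
        by (simp add: nn_integral_0_iff_AE)
      then show "AE W in P'. indicat_real (hs_domain \<epsilon> N) (W(1 := z)) * g (W(1 := z)) = g' (W(1 := z))"
      proof (rule AE_mp, intro AE_I2 impI)
        fix W assume "W \<in> space P'" "(indicator Nl (W(1 := z)) :: ennreal) = 0"
        moreover from this(1) have "W(1 := z) \<in> space P" using measurable_space[OF upd] by blast
        ultimately show "indicat_real (hs_domain \<epsilon> N) (W(1 := z)) * g (W(1 := z)) = g' (W(1 := z))"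
          using Nl(2) by (auto simp: indicator_eq_0_iff)
      qed
    qed
  qed
  then have fm: "AE z in lborel. first_marginal \<epsilon> N g z = enn2real (m z)"
  proof eventually_elim
    fix z
    let ?k = "\<lambda>W. indicat_real (hs_domain \<epsilon> N) (W(1 := z)) * g (W(1 := z))"
    assume k: "AE W in P'. ?k W = g' (W(1 := z))"
    have m1: "(\<lambda>W. g' (W(1 := z))) \<in> borel_measurable P'" by measurable
    then have m2: "(\<lambda>W. g' (W(1 := z))) \<in> borel_measurable (completion P')" by (rule measurable_completion)
    have k': "AE W in completion P'. g' (W(1 := z)) = ?k W" using AE_completion[OF k] by (simp add: eq_commute)
    have "first_marginal \<epsilon> N g z = (\<integral>W. ?k W \<partial>completion P')"
      by (simp add: first_marginal_def config_lebesgue_def P'_def)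
    also have "\<dots> = (\<integral>W. g' (W(1 := z)) \<partial>completion P')"
      using k' m2 completion.borel_measurable_cong_AE[OF m2 k']
      by (intro integral_cong_AE) (auto simp: eq_commute)
    also have "\<dots> = (\<integral>W. g' (W(1 := z)) \<partial>P')" using m1 by (rule integral_completion)
    also have "\<dots> = enn2real (m z)"
      unfolding m_def using m1 nn by (intro integral_eq_nn_integral) auto
    finally show "first_marginal \<epsilon> N g z = enn2real (m z)" .
  qed
  have "(\<lambda>z. enn2real (m z)) \<in> borel_measurable lebesgue"
    by (rule measurable_completion) measurable
  moreover have "AE z in lebesgue. enn2real (m z) = first_marginal \<epsilon> N g z"
    using AE_completion[OF fm] by (simp add: eq_commute)
  ultimately show "first_marginal \<epsilon> N g \<in> borel_measurable lebesgue"
    by (rule completion.borel_measurable_cong_AE)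
  show "AE z in lebesgue. 0 \<le> first_marginal \<epsilon> N g z"
    using AE_completion[OF fm] by eventually_elim simp
  assume h: "h \<in> borel_measurable borel"
  then have [measurable]: "h \<in> borel_measurable lborel" by simp
  have c[measurable]: "(\<lambda>Z. Z 1) \<in> P \<rightarrow>\<^sub>M lborel"
    unfolding P_def by (rule measurable_component_singleton) (use \<open>N \<ge> 1\<close> in auto)
  have "(\<integral>\<^sup>+ z. h z * ennreal (first_marginal \<epsilon> N g z) \<partial>lebesgue)
      = (\<integral>\<^sup>+ z. h z * ennreal (first_marginal \<epsilon> N g z) \<partial>lborel)"
    by (rule nn_integral_completion)
  also have "\<dots> = (\<integral>\<^sup>+ z. h z * m z \<partial>lborel)"
    by (rule nn_integral_cong_AE, use fm fin in eventually_elim) simp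
  also have "\<dots> = (\<integral>\<^sup>+ z. (\<integral>\<^sup>+ W. h ((W(1 := z)) 1) * ennreal (g' (W(1 := z))) \<partial>P') \<partial>lborel)"
  proof (rule nn_integral_cong)
    fix z
    have "(\<lambda>W. ennreal (g' (W(1 := z)))) \<in> borel_measurable P'" by measurable
    from nn_integral_cmult[OF this, of "h z"]
    show "h z * m z = (\<integral>\<^sup>+ W. h ((W(1 := z)) 1) * ennreal (g' (W(1 := z))) \<partial>P')"
      by (simp only: m_def fun_upd_same)
  qed
  also have "\<dots> = (\<integral>\<^sup>+ Z. h (Z 1) * ennreal (g' Z) \<partial>P)"
    by (rule slice[symmetric]) measurable
  also have "\<dots> = (\<integral>\<^sup>+ Z. h (Z 1) * ennreal (g Z) \<partial>hs_measure \<epsilon> N)"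
    by (rule eq[symmetric]) measurable
  finally show "(\<integral>\<^sup>+ z. h z * ennreal (first_marginal \<epsilon> N g z) \<partial>lebesgue)
        = (\<integral>\<^sup>+ Z. h (Z 1) * ennreal (g Z) \<partial>hs_measure \<epsilon> N)" .
qed

text \<open>Exchanging particles 1 and \<open>i\<close> preserves the product measure, the domain
  and, almost everywhere, the density; so particle \<open>i\<close> has the same law as particle
  1.\<close>

lemma nn_integral_hs_density_symmetric:
  fixes g :: "'a::euclidean_space config \<Rightarrow> real"
  assumes i: "i \<in> {1..N}" and pd: "probability_density (hs_measure \<epsilon> N) g"
    and sym: "\<And>\<sigma>. \<sigma> permutes {1..N} \<Longrightarrow> AE Z in hs_measure \<epsilon> N. g (Z \<circ> \<sigma>) = g Z"
    and h: "h \<in> borel_measurable borel"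
  shows "(\<integral>\<^sup>+ Z. h (Z i) * ennreal (g Z) \<partial>hs_measure \<epsilon> N)
    = (\<integral>\<^sup>+ Z. h (Z 1) * ennreal (g Z) \<partial>hs_measure \<epsilon> N)"
proof -
  define P where "P = (config_lborel {1..N} :: 'a config measure)"
  define \<sigma> where "\<sigma> = Transposition.transpose 1 i"
  have \<sigma>: "\<sigma> permutes {1..N}" unfolding \<sigma>_def using i by (intro permutes_swap_id) auto
  have g: "g \<in> borel_measurable (hs_measure \<epsilon> N)" "AE Z in hs_measure \<epsilon> N. 0 \<le> g Z"
    using pd by (auto simp: probability_density_def)
  obtain g' where g'[measurable]: "g' \<in> borel_measurable P" and nn: "\<And>Z. 0 \<le> g' Z"
    and ae: "AE Z in P. indicat_real (hs_domain \<epsilon> N) Z * g Z = g' Z"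
    and eq: "\<And>h. h \<in> borel_measurable P \<Longrightarrow>
      (\<integral>\<^sup>+ Z. h Z * ennreal (g Z) \<partial>hs_measure \<epsilon> N) = (\<integral>\<^sup>+ Z. h Z * ennreal (g' Z) \<partial>P)"
    by (rule hs_density_borel_version[OF g, folded P_def]) (rule that)
  have S[measurable]: "(\<lambda>Z. Z \<circ> \<sigma>) \<in> P \<rightarrow>\<^sub>M P" and dS: "distr P P (\<lambda>Z. Z \<circ> \<sigma>) = P"
    using distr_lborel_product_permute[OF _ \<sigma>] by (auto simp: P_def)
  have domS: "Z \<circ> \<sigma> \<in> hs_domain \<epsilon> N \<longleftrightarrow> Z \<in> hs_domain \<epsilon> N" if "Z \<in> space P" for Z
  proof -
    \<comment> \<open>The condition i < j is not visibly invariant under permutations; by symmetry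
      of the norm it may be replaced by i \<noteq> j, which is.\<close>
    have sd: "W \<in> hs_domain \<epsilon> N \<longleftrightarrow> (\<forall>i\<in>{1..N}. \<forall>j\<in>{1..N}. i \<noteq> j \<longrightarrow> norm (fst (W i) - fst (W j)) > \<epsilon>)"
      if "W \<in> space P" for W
    proof -
      have "W \<in> {1..N} \<rightarrow>\<^sub>E UNIV" using that unfolding P_def space_PiM by simp
      then have "W \<in> hs_domain \<epsilon> N \<longleftrightarrow> (\<forall>i\<in>{1..N}. \<forall>j\<in>{1..N}. i < j \<longrightarrow> norm (fst (W i) - fst (W j)) > \<epsilon>)"
        unfolding hs_domain_def by blast
      also have "\<dots> \<longleftrightarrow> (\<forall>i\<in>{1..N}. \<forall>j\<in>{1..N}. i \<noteq> j \<longrightarrow> norm (fst (W i) - fst (W j)) > \<epsilon>)"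
      proof (intro iffI ballI impI)
        fix i j assume *: "\<forall>i\<in>{1..N}. \<forall>j\<in>{1..N}. i < j \<longrightarrow> norm (fst (W i) - fst (W j)) > \<epsilon>"
          and ij: "i \<in> {1..N}" "j \<in> {1..N}" "i \<noteq> j"
        then consider "i < j" | "j < i" by linarith
        then show "norm (fst (W i) - fst (W j)) > \<epsilon>"
        proof cases
          case 2
          then show ?thesis by (subst norm_minus_commute) (use * ij in blast)
        qed (use * ij in blast)
      qed simp
      finally show ?thesis .
    qed
    have im: "\<sigma> k \<in> {1..N} \<longleftrightarrow> k \<in> {1..N}" "\<sigma> k = \<sigma> l \<longleftrightarrow> k = l" for k l
      using permutes_in_image[OF \<sigma>] permutes_inj[OF \<sigma>] by (auto dest: injD)
    have surj: "\<exists>k'\<in>{1..N}. k = \<sigma> k'" if "k \<in> {1..N}" for k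
      using permutes_image[OF \<sigma>] that by blast
    have "Z \<circ> \<sigma> \<in> space P" using measurable_space[OF S that] .
    show ?thesis
      unfolding sd[OF that] sd[OF \<open>Z \<circ> \<sigma> \<in> space P\<close>] unfolding o_def
    proof (intro iffI ballI impI)
      fix k l assume *: "\<forall>i\<in>{1..N}. \<forall>j\<in>{1..N}. i \<noteq> j \<longrightarrow> \<epsilon> < norm (fst (Z (\<sigma> i)) - fst (Z (\<sigma> j)))"
        and kl: "k \<in> {1..N}" "l \<in> {1..N}" "k \<noteq> l"
      obtain k' where k': "k' \<in> {1..N}" "k = \<sigma> k'" using surj[OF kl(1)] by blast
      obtain l' where l': "l' \<in> {1..N}" "l = \<sigma> l'" using surj[OF kl(2)] by blast
      have ne: "k' \<noteq> l'" using kl(3) k'(2) l'(2) by blast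
      show "\<epsilon> < norm (fst (Z k) - fst (Z l))"
        unfolding k'(2) l'(2) by (rule *[rule_format, OF k'(1) l'(1) ne])
    next
      fix k l assume *: "\<forall>i\<in>{1..N}. \<forall>j\<in>{1..N}. i \<noteq> j \<longrightarrow> \<epsilon> < norm (fst (Z i) - fst (Z j))"
        and kl: "k \<in> {1..N}" "l \<in> {1..N}" "k \<noteq> l"
      show "\<epsilon> < norm (fst (Z (\<sigma> k)) - fst (Z (\<sigma> l)))"
        using kl im(2)[of k l] by (intro *[rule_format]) (simp_all only: im(1) not_False_eq_True)
    qed
  qed
  have "AE Z in distr P P (\<lambda>Z. Z \<circ> \<sigma>). indicat_real (hs_domain \<epsilon> N) Z * g Z = g' Z"
    using ae unfolding dS .
  then have "AE Z in P. indicat_real (hs_domain \<epsilon> N) (Z \<circ> \<sigma>) * g (Z \<circ> \<sigma>) = g' (Z \<circ> \<sigma>)"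
    by (rule AE_distrD[OF S])
  moreover have "AE Z in P. Z \<in> hs_domain \<epsilon> N \<longrightarrow> g (Z \<circ> \<sigma>) = g Z"
    using sym[OF \<sigma>] unfolding AE_hs_measure P_def .
  ultimately have gS: "AE Z in P. g' (Z \<circ> \<sigma>) = g' Z"
    using ae AE_space by eventually_elim (auto simp: domS indicator_def split: if_splits)
  have c[measurable]: "(\<lambda>Z. Z k) \<in> P \<rightarrow>\<^sub>M borel" if "k \<in> {1..N}" for k
    using measurable_component_singleton[OF that, of "\<lambda>_. lborel :: ('a \<times> 'a) measure"] by (simp add: P_def)
  have one: "1 \<in> {1..N}" using i by auto
  note [measurable] = h c[OF i] c[OF one]
  have "(\<integral>\<^sup>+ Z. h (Z 1) * ennreal (g Z) \<partial>hs_measure \<epsilon> N) = (\<integral>\<^sup>+ Z. h (Z 1) * ennreal (g' Z) \<partial>P)"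
    by (rule eq) measurable
  also have "\<dots> = (\<integral>\<^sup>+ Z. h (Z 1) * ennreal (g' Z) \<partial>distr P P (\<lambda>Z. Z \<circ> \<sigma>))"
    by (simp add: dS)
  also have "\<dots> = (\<integral>\<^sup>+ Z. h ((Z \<circ> \<sigma>) 1) * ennreal (g' (Z \<circ> \<sigma>)) \<partial>P)"
    by (rule nn_integral_distr[OF S]) measurable
  also have "\<dots> = (\<integral>\<^sup>+ Z. h (Z i) * ennreal (g' Z) \<partial>P)"
    by (rule nn_integral_cong_AE, use gS in eventually_elim) (simp add: \<sigma>_def)
  also have "\<dots> = (\<integral>\<^sup>+ Z. h (Z i) * ennreal (g Z) \<partial>hs_measure \<epsilon> N)"
    by (rule eq[symmetric]) measurable
  finally show ?thesis ..
qed

section \<open>Invariance of the measure under the flow\<close>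

text \<open>\<open>\<psi> t\<close> preserves measure but may leave the domain on a null set, so it
  need not be a measurable map of the space into itself. It is modified on that null set, and the
  conclusions return to \<open>\<psi> t\<close> by completeness.\<close>

lemma hs_flow_preserves:
  fixes \<psi> :: "real \<Rightarrow> 'a::euclidean_space config \<Rightarrow> 'a config"
    and h :: "'a config \<Rightarrow> 'b::topological_space" and k :: "'a config \<Rightarrow> ennreal"
  assumes flow: "hs_flow \<epsilon> N \<psi>"
  shows hs_flow_measurable: "h \<in> borel_measurable (hs_measure \<epsilon> N) \<Longrightarrow>
      (\<lambda>Z. h (\<psi> t Z)) \<in> borel_measurable (hs_measure \<epsilon> N)"
    and hs_flow_nn_integral: "k \<in> borel_measurable (hs_measure \<epsilon> N) \<Longrightarrow>
      (\<integral>\<^sup>+ Z. k (\<psi> t Z) \<partial>hs_measure \<epsilon> N) = (\<integral>\<^sup>+ Z. k Z \<partial>hs_measure \<epsilon> N)"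
    and hs_flow_AE: "AE Z in hs_measure \<epsilon> N. Q Z \<Longrightarrow> AE Z in hs_measure \<epsilon> N. Q (\<psi> t Z)"
proof -
  define \<mu> where "\<mu> = (hs_measure \<epsilon> N :: 'a config measure)"
  define D where "D = (hs_domain \<epsilon> N :: 'a config set)"
  interpret complete_measure \<mu> unfolding \<mu>_def by (rule complete_hs_measure)
  have sp: "space \<mu> = D" by (simp add: \<mu>_def D_def space_hs_measure)
  have inD: "AE Z in \<mu>. \<psi> t Z \<in> D"
    and vim: "\<And>A. A \<in> sets \<mu> \<Longrightarrow> \<psi> t -` A \<inter> D \<in> sets \<mu>"
    and emb: "\<And>A. A \<in> sets \<mu> \<Longrightarrow> emeasure \<mu> (\<psi> t -` A \<inter> D) = emeasure \<mu> A"
    using flow unfolding hs_flow_def \<mu>_def D_def by blast+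
  \<comment> \<open>The identity serves as default wherever \<open>\<psi> t\<close> leaves the
    domain, which makes \<open>S\<close> a genuine measure preserving map.\<close>
  define S where "S Z = (if \<psi> t Z \<in> D then \<psi> t Z else Z)" for Z
  have Seq: "AE Z in \<mu>. S Z = \<psi> t Z" using inD by eventually_elim (simp add: S_def)
  have S: "S \<in> \<mu> \<rightarrow>\<^sub>M \<mu>"
  proof (rule measurableI)
    fix A assume A: "A \<in> sets \<mu>"
    then have "A \<subseteq> D" using sets.sets_into_space sp by blast
    then have "S -` A \<inter> space \<mu> = (\<psi> t -` A \<inter> D) \<union> (A - (\<psi> t -` D \<inter> D))"
      by (auto simp: S_def sp split: if_splits)
    moreover have "D \<in> sets \<mu>" using sets.top[of \<mu>] by (simp add: sp)
    ultimately show "S -` A \<inter> space \<mu> \<in> sets \<mu>" using vim A by auto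
  qed (auto simp: S_def sp)
  have distr: "distr \<mu> \<mu> S = \<mu>"
  proof (rule measure_eqI)
    fix A assume "A \<in> sets (distr \<mu> \<mu> S)"
    then have A: "A \<in> sets \<mu>" by simp
    have "emeasure (distr \<mu> \<mu> S) A = emeasure \<mu> (S -` A \<inter> space \<mu>)"
      by (rule emeasure_distr[OF S A])
    also have "\<dots> = emeasure \<mu> (\<psi> t -` A \<inter> D)"
    proof (rule emeasure_eq_AE)
      show "AE Z in \<mu>. Z \<in> S -` A \<inter> space \<mu> \<longleftrightarrow> Z \<in> \<psi> t -` A \<inter> D"
        using Seq by eventually_elim (auto simp: sp)
    qed (use A vim measurable_sets[OF S A] in auto)
    finally show "emeasure (distr \<mu> \<mu> S) A = emeasure \<mu> A" using emb[OF A] by simp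
  qed simp
  show "(\<lambda>Z. h (\<psi> t Z)) \<in> borel_measurable (hs_measure \<epsilon> N)" if "h \<in> borel_measurable (hs_measure \<epsilon> N)"
    unfolding \<mu>_def[symmetric]
  proof (rule borel_measurable_cong_AE)
    show "(\<lambda>Z. h (S Z)) \<in> borel_measurable \<mu>"
      using measurable_compose[OF S] that by (simp add: \<mu>_def)
    show "AE Z in \<mu>. h (S Z) = h (\<psi> t Z)" using Seq by eventually_elim simp
  qed
  show "(\<integral>\<^sup>+ Z. k (\<psi> t Z) \<partial>hs_measure \<epsilon> N) = (\<integral>\<^sup>+ Z. k Z \<partial>hs_measure \<epsilon> N)"
    if "k \<in> borel_measurable (hs_measure \<epsilon> N)"
    unfolding \<mu>_def[symmetric]
  proof -
    have "(\<integral>\<^sup>+ Z. k (\<psi> t Z) \<partial>\<mu>) = (\<integral>\<^sup>+ Z. k (S Z) \<partial>\<mu>)"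
      by (rule nn_integral_cong_AE, use Seq in eventually_elim) simp
    also have "\<dots> = (\<integral>\<^sup>+ Z. k Z \<partial>distr \<mu> \<mu> S)"
      using that by (intro nn_integral_distr[OF S, symmetric]) (simp add: \<mu>_def)
    finally show "(\<integral>\<^sup>+ Z. k (\<psi> t Z) \<partial>\<mu>) = (\<integral>\<^sup>+ Z. k Z \<partial>\<mu>)" by (simp add: distr)
  qed
  show "AE Z in hs_measure \<epsilon> N. Q (\<psi> t Z)" if "AE Z in hs_measure \<epsilon> N. Q Z"
    unfolding \<mu>_def[symmetric]
  proof -
    have "AE Z in distr \<mu> \<mu> S. Q Z" using that unfolding distr \<mu>_def[symmetric] .
    then have "AE Z in \<mu>. Q (S Z)" by (rule AE_distrD[OF S])
    with Seq show "AE Z in \<mu>. Q (\<psi> t Z)" by eventually_elim simp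
  qed
qed

section \<open>Weak transport estimate for the first marginal\<close>

text \<open>Drawing Z from the density at time 0 and following the flow amounts to drawing from the
  density at time t, by the Liouville equation and invariance of the measure; symmetry then turns
  particle \<open>i\<close> into particle 1. The map z to z on the right only restricts Lebesgue
  sets to Borel sets, so that both sides are measures on \<open>borel\<close>.\<close>

lemma hs_flow_phase_distr:
  fixes \<psi> :: "real \<Rightarrow> 'a::euclidean_space config \<Rightarrow> 'a config"
  assumes flow: "hs_flow \<epsilon> N \<psi>" and i: "i \<in> {1..N}"
    and pd0: "probability_density (hs_measure \<epsilon> N) g0"
    and pd: "probability_density (hs_measure \<epsilon> N) g"
    and liouville: "AE Z in hs_measure \<epsilon> N. g Z = g0 (\<psi> (- t) Z)"
    and sym: "\<And>\<sigma>. \<sigma> permutes {1..N} \<Longrightarrow> AE Z in hs_measure \<epsilon> N. g (Z \<circ> \<sigma>) = g Z"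
  shows measurable_hs_flow_component: "(\<lambda>Z. \<psi> t Z i) \<in> borel_measurable (hs_measure \<epsilon> N)"
    and distr_hs_flow_component:
      "distr (density (hs_measure \<epsilon> N) (\<lambda>Z. ennreal (g0 Z))) borel (\<lambda>Z. \<psi> t Z i)
        = distr (density lebesgue (\<lambda>z. ennreal (first_marginal \<epsilon> N g z))) borel (\<lambda>z. z)"
proof -
  let ?\<mu> = "hs_measure \<epsilon> N :: 'a config measure"
  have N: "N \<ge> 1" using i by auto
  have comp: "(\<lambda>Z :: 'a config. Z i) \<in> borel_measurable ?\<mu>"
    using measurable_component_singleton[OF i, of "\<lambda>_. lborel :: ('a \<times> 'a) measure"]
    by (intro measurable_hs_measureI) simp
  then show m: "(\<lambda>Z. \<psi> t Z i) \<in> borel_measurable ?\<mu>"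
    by (rule hs_flow_measurable[OF flow, of "\<lambda>Z. Z i"])
  have g0: "g0 \<in> borel_measurable ?\<mu>" and g: "g \<in> borel_measurable ?\<mu>"
    using pd0 pd by (auto simp: probability_density_def)
  have fm: "first_marginal \<epsilon> N g \<in> borel_measurable lebesgue"
    by (rule borel_measurable_first_marginal[OF N pd])
  have "AE Z in ?\<mu>. \<psi> 0 Z = Z \<and> hs_trajectory \<epsilon> N (\<lambda>t. \<psi> t Z)"
    using flow unfolding hs_flow_def by blast
  moreover have "AE Z in ?\<mu>. \<psi> (- t + t) Z = \<psi> (- t) (\<psi> t Z)"
    using flow unfolding hs_flow_def by blast
  \<comment> \<open>The Liouville identity holds for almost every Z; evaluating it at
    \<open>\<psi> t Z\<close> is legitimate because the flow pulls null sets back to null sets. The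
    group law at - t + t = 0 then leaves \<open>g0 Z\<close>.\<close>
  moreover have "AE Z in ?\<mu>. g (\<psi> t Z) = g0 (\<psi> (- t) (\<psi> t Z))"
    by (rule hs_flow_AE[OF flow liouville])
  ultimately have gg0: "AE Z in ?\<mu>. g (\<psi> t Z) = g0 Z"
    by eventually_elim simp
  show "distr (density ?\<mu> (\<lambda>Z. ennreal (g0 Z))) borel (\<lambda>Z. \<psi> t Z i)
        = distr (density lebesgue (\<lambda>z. ennreal (first_marginal \<epsilon> N g z))) borel (\<lambda>z. z)"
  proof (rule measure_eqI)
    fix A assume "A \<in> sets (distr (density ?\<mu> (\<lambda>Z. ennreal (g0 Z))) borel (\<lambda>Z. \<psi> t Z i))"
    then have A: "A \<in> sets borel" by simp
    then have ind: "(indicator A :: _ \<Rightarrow> ennreal) \<in> borel_measurable borel" by simp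
    have k: "(\<lambda>Z. indicator A (Z i) * ennreal (g Z)) \<in> borel_measurable ?\<mu>"
      using g measurable_compose[OF comp ind] by measurable
    have "emeasure (distr (density lebesgue (\<lambda>z. ennreal (first_marginal \<epsilon> N g z))) borel (\<lambda>z. z)) A
      = emeasure (density lebesgue (\<lambda>z. ennreal (first_marginal \<epsilon> N g z))) A"
      using A id_borel_measurable_lebesgue by (subst emeasure_distr) (auto simp: id_def)
    also have "\<dots> = (\<integral>\<^sup>+ z. indicator A z * ennreal (first_marginal \<epsilon> N g z) \<partial>lebesgue)"
      using A fm by (subst emeasure_density) (auto simp: mult.commute)
    also have "\<dots> = (\<integral>\<^sup>+ Z. indicator A (Z 1) * ennreal (g Z) \<partial>?\<mu>)"
      by (rule nn_integral_first_marginal[OF N pd ind])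
    also have "\<dots> = (\<integral>\<^sup>+ Z. indicator A (Z i) * ennreal (g Z) \<partial>?\<mu>)"
      by (rule nn_integral_hs_density_symmetric[OF i pd sym ind, symmetric])
    also have "\<dots> = (\<integral>\<^sup>+ Z. indicator A (\<psi> t Z i) * ennreal (g (\<psi> t Z)) \<partial>?\<mu>)"
      by (rule hs_flow_nn_integral[OF flow k, symmetric])
    also have "\<dots> = (\<integral>\<^sup>+ Z. indicator A (\<psi> t Z i) * ennreal (g0 Z) \<partial>?\<mu>)"
      by (rule nn_integral_cong_AE, use gg0 in eventually_elim) simp
    also have "\<dots> = (\<integral>\<^sup>+ Z. ennreal (g0 Z) * indicator ((\<lambda>Z. \<psi> t Z i) -` A \<inter> space ?\<mu>) Z \<partial>?\<mu>)"
      by (rule nn_integral_cong) (simp add: indicator_def mult.commute)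
    also have "\<dots> = emeasure (density ?\<mu> (\<lambda>Z. ennreal (g0 Z))) ((\<lambda>Z. \<psi> t Z i) -` A \<inter> space ?\<mu>)"
      using g0 measurable_sets[OF m A] by (subst emeasure_density) auto
    also have "\<dots> = emeasure (distr (density ?\<mu> (\<lambda>Z. ennreal (g0 Z))) borel (\<lambda>Z. \<psi> t Z i)) A"
      using m A by (subst emeasure_distr) auto
    finally show "emeasure (distr (density ?\<mu> (\<lambda>Z. ennreal (g0 Z))) borel (\<lambda>Z. \<psi> t Z i)) A =
      emeasure (distr (density lebesgue (\<lambda>z. ennreal (first_marginal \<epsilon> N g z))) borel (\<lambda>z. z)) A" ..
  qed simp
qed

text \<open>Equal laws have equal integrals. Integrability is kept as an equivalence because the
  virial, unlike the transport derivative of a test function, is unbounded.\<close>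

lemma hs_flow_expectation:
  fixes \<psi> :: "real \<Rightarrow> 'a::euclidean_space config \<Rightarrow> 'a config" and h :: "'a \<times> 'a \<Rightarrow> real"
  assumes flow: "hs_flow \<epsilon> N \<psi>" and i: "i \<in> {1..N}"
    and pd0: "probability_density (hs_measure \<epsilon> N) g0"
    and pd: "probability_density (hs_measure \<epsilon> N) g"
    and liouville: "AE Z in hs_measure \<epsilon> N. g Z = g0 (\<psi> (- t) Z)"
    and sym: "\<And>\<sigma>. \<sigma> permutes {1..N} \<Longrightarrow> AE Z in hs_measure \<epsilon> N. g (Z \<circ> \<sigma>) = g Z"
    and h: "h \<in> borel_measurable borel"
  defines "Pr \<equiv> density (hs_measure \<epsilon> N) (\<lambda>Z. ennreal (g0 Z))"
  shows "integrable Pr (\<lambda>Z. h (\<psi> t Z i)) \<longleftrightarrow> integrable lebesgue (\<lambda>z. h z * first_marginal \<epsilon> N g z)"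
    and "(\<integral>Z. h (\<psi> t Z i) \<partial>Pr) = (\<integral>z. h z * first_marginal \<epsilon> N g z \<partial>lebesgue)"
proof -
  have N: "N \<ge> 1" using i by auto
  let ?\<nu> = "density lebesgue (\<lambda>z. ennreal (first_marginal \<epsilon> N g z))"
  have m: "(\<lambda>Z. \<psi> t Z i) \<in> borel_measurable Pr"
    using measurable_hs_flow_component[OF flow i pd0 pd liouville sym] by (simp add: Pr_def)
  have id: "(\<lambda>z. z) \<in> borel_measurable ?\<nu>"
    using id_borel_measurable_lebesgue by (simp add: id_def)
  have d: "distr Pr borel (\<lambda>Z. \<psi> t Z i) = distr ?\<nu> borel (\<lambda>z. z)"
    unfolding Pr_def by (rule distr_hs_flow_component[OF flow i pd0 pd liouville sym])
  have fm: "first_marginal \<epsilon> N g \<in> borel_measurable lebesgue" "AE z in lebesgue. 0 \<le> first_marginal \<epsilon> N g z"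
    by (rule borel_measurable_first_marginal[OF N pd], rule AE_first_marginal_nonneg[OF N pd])
  have h': "h \<in> borel_measurable lebesgue" using h by (simp add: measurable_completion)
  show "integrable Pr (\<lambda>Z. h (\<psi> t Z i)) \<longleftrightarrow> integrable lebesgue (\<lambda>z. h z * first_marginal \<epsilon> N g z)"
    using integrable_distr_eq[OF m h] integrable_distr_eq[OF id h] integrable_density[OF h' fm]
    unfolding d by (simp add: mult.commute)
  show "(\<integral>Z. h (\<psi> t Z i) \<partial>Pr) = (\<integral>z. h z * first_marginal \<epsilon> N g z \<partial>lebesgue)"
    using integral_distr[OF m h] integral_distr[OF id h] integral_density[OF h' fm]
    unfolding d by (simp add: mult.commute)
qed

lemma emeasure_density_probability:
  "probability_density M g \<Longrightarrow> emeasure (density M (\<lambda>x. ennreal (g x))) (space M) = 1"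
  by (subst emeasure_density) (auto simp: probability_density_def cong: nn_integral_cong_simp)

definition phase_virial :: "real \<Rightarrow> 'a::euclidean_space \<times> 'a \<Rightarrow> real" where
  "phase_virial t z = fst z \<bullet> snd z - (norm (snd z))\<^sup>2 * t"

lemma virial_eq_sum: "virial N t Z = (\<Sum>i=1..N. phase_virial t (Z i))"
  by (simp add: virial_def phase_virial_def)

lemma borel_measurable_phase_virial: "phase_virial t \<in> borel_measurable borel"
  unfolding phase_virial_def[abs_def] by (intro borel_measurable_continuous_onI continuous_intros)

text \<open>The mean of the bound along one trajectory over random initial data. Since \<phi>
  vanishes at times \<open>a\<close> and \<open>b\<close>, the boundary sums drop out; by symmetry
  each side is N times an integral against the first marginal, and N cancels.\<close>

lemma hs_weak_transport_bound:
  fixes \<psi> :: "real \<Rightarrow> 'a::euclidean_space config \<Rightarrow> 'a config"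
    and F :: "real \<Rightarrow> 'a config \<Rightarrow> real"
  assumes flow: "hs_flow \<epsilon> N \<psi>" and "N \<ge> 1" "\<epsilon> > 0" "a < b"
    and pd0: "probability_density (hs_measure \<epsilon> N) (F 0)"
    and pd: "\<And>t. t \<in> {a..b} \<Longrightarrow> probability_density (hs_measure \<epsilon> N) (F t)"
    and liouville: "\<And>t. t \<in> {a..b} \<Longrightarrow> AE Z in hs_measure \<epsilon> N. F t Z = F 0 (\<psi> (- t) Z)"
    and sym: "\<And>t \<sigma>. t \<in> {a..b} \<Longrightarrow> \<sigma> permutes {1..N} \<Longrightarrow>
      AE Z in hs_measure \<epsilon> N. F t (Z \<circ> \<sigma>) = F t Z"
    and test: "test_function ({a<..<b} \<times> UNIV) \<phi>"
    and lip: "\<And>p q. \<bar>\<phi> p - \<phi> q\<bar> \<le> L * norm (p - q)"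
    and bound: "\<And>p. \<bar>transport_derivative \<phi> p\<bar> \<le> M"
  defines "A \<equiv> \<lambda>s. \<integral>z. transport_derivative \<phi> (s, z) * first_marginal \<epsilon> N (F s) z \<partial>lebesgue"
    and "B \<equiv> \<lambda>s. \<integral>z. phase_virial s z * first_marginal \<epsilon> N (F s) z \<partial>lebesgue"
  shows "continuous_on {a..b} A"
    and "\<And>s. s \<in> {a..b} \<Longrightarrow> \<bar>A s\<bar> \<le> M"
    and "integrable lebesgue (\<lambda>z. phase_virial a z * first_marginal \<epsilon> N (F a) z) \<Longrightarrow>
      integrable lebesgue (\<lambda>z. phase_virial b z * first_marginal \<epsilon> N (F b) z) \<Longrightarrow>
      \<bar>integral {a..b} A\<bar> \<le> 2 * L / \<epsilon> * (B b - B a)"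
proof -
  define D where "D = (hs_domain \<epsilon> N :: 'a config set)"
  define \<mu> where "\<mu> = (hs_measure \<epsilon> N :: 'a config measure)"
  define Pr where "Pr = density \<mu> (\<lambda>Z. ennreal (F 0 Z))"
  define u where "u s Z = (\<Sum>i=1..N. transport_derivative \<phi> (s, \<psi> s Z i))" for s Z
  have spPr: "space Pr = space \<mu>" by (simp add: Pr_def)
  have emPr: "emeasure Pr (space Pr) = 1"
    unfolding Pr_def \<mu>_def using emeasure_density_probability[OF pd0] by simp
  then interpret finite_measure Pr by (intro finite_measureI) simp
  have mPr: "measure Pr (space Pr) = 1" using emPr by (simp add: measure_def)
  have AE_Pr: "AE Z in Pr. Q Z" if "AE Z in \<mu>. Q Z" for Q
  proof -
    have "(\<lambda>Z. ennreal (F 0 Z)) \<in> borel_measurable \<mu>"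
      using pd0 by (auto simp: probability_density_def \<mu>_def)
    from AE_density[OF this] that show ?thesis unfolding Pr_def by auto
  qed
  have traj: "AE Z in Pr. hs_trajectory \<epsilon> N (\<lambda>t. \<psi> t Z)"
    using flow unfolding hs_flow_def \<mu>_def[symmetric] by (intro AE_Pr) auto
  have dom: "AE Z in Pr. \<psi> t Z \<in> D" for t
    using flow unfolding hs_flow_def \<mu>_def[symmetric] D_def[symmetric] by (intro AE_Pr) auto
  have C1: "Ck (Suc 0) \<phi>" using test unfolding test_function_def by blast
  have contD: "continuous_on UNIV (transport_derivative \<phi>)"
    using Ck_transport_derivative[OF C1] by simp
  have td_m: "(\<lambda>z. transport_derivative \<phi> (s, z)) \<in> borel_measurable borel" for s
    by (intro borel_measurable_continuous_onI continuous_on_compose2[OF contD] continuous_intros) auto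
  have comp_m: "(\<lambda>Z. \<psi> s Z i) \<in> borel_measurable Pr" if "s \<in> {a..b}" "i \<in> {1..N}" for s i
    using measurable_hs_flow_component[OF flow that(2) pd0 pd[OF that(1)] liouville[OF that(1)] sym[OF that(1)]]
    by (simp add: Pr_def \<mu>_def)
  have u_bound: "\<bar>u s Z\<bar> \<le> real N * M" for s Z
    unfolding u_def using sum_norm_bound[of "{1..N}" "\<lambda>i. transport_derivative \<phi> (s, \<psi> s Z i)" M] bound
    by simp
  have u_m: "u s \<in> borel_measurable Pr" if "s \<in> {a..b}" for s
    unfolding u_def[abs_def] using that
    by (intro borel_measurable_sum measurable_compose[OF comp_m td_m]) auto
  have E1: "integrable Pr (\<lambda>Z. h (\<psi> s Z i)) \<longleftrightarrow> integrable lebesgue (\<lambda>z. h z * first_marginal \<epsilon> N (F s) z)"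
      "(\<integral>Z. h (\<psi> s Z i) \<partial>Pr) = (\<integral>z. h z * first_marginal \<epsilon> N (F s) z \<partial>lebesgue)"
    if "s \<in> {a..b}" "i \<in> {1..N}" "h \<in> borel_measurable borel" for s i and h :: "'a \<times> 'a \<Rightarrow> real"
    using hs_flow_expectation[OF flow that(2) pd0 pd[OF that(1)] liouville[OF that(1)] sym[OF that(1)] that(3)]
    unfolding Pr_def \<mu>_def by blast+
  have td_int: "integrable Pr (\<lambda>Z. transport_derivative \<phi> (s, \<psi> s Z i))" if "s \<in> {a..b}" "i \<in> {1..N}" for s i
    using bound by (intro integrable_const_bound[of _ M] measurable_compose[OF comp_m td_m] that) auto
  have td_E: "(\<integral>Z. transport_derivative \<phi> (s, \<psi> s Z i) \<partial>Pr) = A s" if "s \<in> {a..b}" "i \<in> {1..N}" for s i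
    unfolding A_def using E1(2)[OF that td_m] .
  have u_E: "(\<integral>Z. u s Z \<partial>Pr) = real N * A s" if "s \<in> {a..b}" for s
    unfolding u_def using td_int[OF that] td_E[OF that] by (subst Bochner_Integration.integral_sum) auto
  have u_int: "integrable Pr (u s)" if "s \<in> {a..b}" for s
    unfolding u_def[abs_def] using td_int[OF that] by auto
  show A_bound: "\<bar>A s\<bar> \<le> M" if s: "s \<in> {a..b}" for s
  proof -
    have one: "1 \<in> {1..N}" using \<open>N \<ge> 1\<close> by auto
    have "\<bar>A s\<bar> \<le> (\<integral>Z. \<bar>transport_derivative \<phi> (s, \<psi> s Z 1)\<bar> \<partial>Pr)"
      unfolding td_E[OF s one, symmetric] by (rule integral_abs_bound)
    also have "\<dots> \<le> (\<integral>Z. M \<partial>Pr)"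
      using td_int[OF s one] bound by (intro integral_mono) auto
    finally show ?thesis using mPr by simp
  qed
  \<comment> \<open>Trajectories jump at times depending on Z, but for fixed \<open>s\<close> almost
    no Z has a collision at time \<open>s\<close>. So the observable is continuous at
    \<open>s\<close> almost surely, and its constant bound \<open>real N * M\<close> permits
    dominated convergence.\<close>
  show A_cont: "continuous_on {a..b} A"
    unfolding continuous_on_sequentially o_def
  proof (intro ballI allI impI, elim conjE)
    fix x s assume s: "s \<in> {a..b}" and x: "\<forall>n. x n \<in> {a..b}" "x \<longlonglongrightarrow> s"
    have "(\<lambda>n. \<integral>Z. u (x n) Z \<partial>Pr) \<longlonglongrightarrow> (\<integral>Z. u s Z \<partial>Pr)"
    proof (rule integral_dominated_convergence[where w = "\<lambda>_. real N * M"])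
      show "AE Z in Pr. (\<lambda>n. u (x n) Z) \<longlonglongrightarrow> u s Z"
        using traj dom[of s]
      proof eventually_elim
        fix Z assume "hs_trajectory \<epsilon> N (\<lambda>t. \<psi> t Z)" "\<psi> s Z \<in> D"
        then have "isCont (\<lambda>s. u s Z) s"
          unfolding u_def by (intro hs_trajectory_isCont[where \<gamma> = "\<lambda>t. \<psi> t Z"] contD) (auto simp: D_def)
        then show "(\<lambda>n. u (x n) Z) \<longlonglongrightarrow> u s Z"
          using x(2) by (rule isCont_tendsto_compose)
      qed
    qed (use u_m s x u_bound in auto)
    then have "(\<lambda>n. real N * A (x n)) \<longlonglongrightarrow> real N * A s"
      using x(1) s by (simp add: u_E)
    then have "(\<lambda>n. (real N * A (x n)) / real N) \<longlonglongrightarrow> (real N * A s) / real N"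
      by (intro tendsto_divide tendsto_const) (use \<open>N \<ge> 1\<close> in auto)
    then show "(\<lambda>n. A (x n)) \<longlonglongrightarrow> A s" using \<open>N \<ge> 1\<close> by simp
  qed
  txt \<open>Riemann sums replace Fubini's theorem: \<open>\<psi> s Z\<close> need not be jointly measurable in
    \<open>(s, Z)\<close>.\<close>
  define R where "R v n = (b - a) / real (Suc n) * (\<Sum>k\<le>n. v (a + real k * ((b - a) / real (Suc n))))"
    for v :: "real \<Rightarrow> real" and n
  have node: "a + real k * ((b - a) / real (Suc n)) \<in> {a..b}" if "k \<le> n" for k n
  proof -
    have "real k * ((b - a) / real (Suc n)) \<le> real (Suc n) * ((b - a) / real (Suc n))"
      using that \<open>a < b\<close> by (intro mult_right_mono) auto
    then show ?thesis using \<open>a < b\<close> by simp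
  qed
  have R_bound: "\<bar>R v n\<bar> \<le> (b - a) * K" if "\<And>s. \<bar>v s\<bar> \<le> K" for v n K
  proof -
    have "\<bar>\<Sum>k\<le>n. v (a + real k * ((b - a) / real (Suc n)))\<bar> \<le> real (Suc n) * K"
      using sum_norm_bound[of "{..n}" "\<lambda>k. v (a + real k * ((b - a) / real (Suc n)))" K] that by simp
    then have "\<bar>R v n\<bar> \<le> (b - a) / real (Suc n) * (real (Suc n) * K)"
      unfolding R_def abs_mult using \<open>a < b\<close> by (intro mult_mono) auto
    then show ?thesis by simp
  qed
  \<comment> \<open>A limit of measurable functions is measurable in Z; for almost every Z it will
    turn out to be the time integral.\<close>
  define RL where "RL Z = lim (\<lambda>n. R (\<lambda>s. u s Z) n)" for Z
  have R_m: "(\<lambda>Z. R (\<lambda>s. u s Z) n) \<in> borel_measurable Pr" for n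
    unfolding R_def using node by (intro borel_measurable_times borel_measurable_sum u_m) auto
  have RL_m: "RL \<in> borel_measurable Pr"
    unfolding RL_def[abs_def] by (rule borel_measurable_lim_metric) (rule R_m)
  \<comment> \<open>The closed support lies in the open time strip, so \<phi> vanishes at the end
    times as well.\<close>
  have outside: "\<phi> p = 0" if "fst p \<notin> {a<..<b}" for p
  proof (rule ccontr)
    assume "\<phi> p \<noteq> 0"
    then have "p \<in> closure {p. \<phi> p \<noteq> 0}" by (intro subsetD[OF closure_subset]) simp
    moreover have "closure {p. \<phi> p \<noteq> 0} \<subseteq> {a<..<b} \<times> UNIV"
      using test by (simp add: test_function_def)
    ultimately show False using that by (auto simp: mem_Times_iff)
  qed
  have ends: "\<phi> (a, z) = 0" "\<phi> (b, z) = 0" for z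
    by (auto intro: outside)
  have key: "AE Z in Pr. (\<lambda>n. R (\<lambda>s. u s Z) n) \<longlonglongrightarrow> RL Z \<and>
      \<bar>RL Z\<bar> \<le> 2 * L / \<epsilon> * (virial N b (\<psi> b Z) - virial N a (\<psi> a Z))"
    using traj dom[of a] dom[of b]
  proof eventually_elim
    fix Z assume tr: "hs_trajectory \<epsilon> N (\<lambda>t. \<psi> t Z)" and ab: "\<psi> a Z \<in> D" "\<psi> b Z \<in> D"
    define S where "S = {t \<in> {a..b}. \<psi> t Z \<notin> D}"
    have "finite S" using tr unfolding hs_trajectory_def S_def D_def by blast
    then have neg: "negligible S" by (rule negligible_finite)
    have cont: "continuous (at t within {a..b}) (\<lambda>s. u s Z)" if "t \<in> {a..b} - S" for t
    proof -
      have "\<psi> t Z \<in> hs_domain \<epsilon> N" using that by (auto simp: S_def D_def)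
      then have "isCont (\<lambda>s. u s Z) t"
        unfolding u_def by (rule hs_trajectory_isCont[where \<gamma> = "\<lambda>t. \<psi> t Z", OF tr _ contD])
      then show ?thesis by (rule continuous_at_imp_continuous_at_within)
    qed
    note rs = riemann_sums_tendsto[OF \<open>a < b\<close> u_bound neg cont]
    have lim: "(\<lambda>n. R (\<lambda>s. u s Z) n) \<longlonglongrightarrow> integral {a..b} (\<lambda>s. u s Z)"
      using rs(2) unfolding R_def .
    then have RL: "RL Z = integral {a..b} (\<lambda>s. u s Z)"
      unfolding RL_def by (rule limI)
    have lipv: "\<bar>\<phi> (t, x, v') - \<phi> (t, x, v)\<bar> \<le> L * norm (v' - v)" for t x v v'
      using lip[of "(t, x, v')" "(t, x, v)"] by (simp add: norm_Pair)
    have "\<epsilon> * \<bar>integral {a..b} (\<lambda>s. u s Z)\<bar> \<le> 2 * L * (virial N b (\<psi> b Z) - virial N a (\<psi> a Z))"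
      using hs_trajectory_transport_bound[OF tr \<open>\<epsilon> > 0\<close> \<open>a < b\<close> _ _ C1 lipv] ab rs(1)
      unfolding u_def D_def by (simp add: ends)
    then have "\<bar>RL Z\<bar> \<le> 2 * L / \<epsilon> * (virial N b (\<psi> b Z) - virial N a (\<psi> a Z))"
      using \<open>\<epsilon> > 0\<close> by (simp add: RL field_simps)
    with lim show "(\<lambda>n. R (\<lambda>s. u s Z) n) \<longlonglongrightarrow> RL Z \<and>
        \<bar>RL Z\<bar> \<le> 2 * L / \<epsilon> * (virial N b (\<psi> b Z) - virial N a (\<psi> a Z))"
      unfolding RL by blast
  qed
  have DCT: "integrable Pr RL" "(\<lambda>n. \<integral>Z. R (\<lambda>s. u s Z) n \<partial>Pr) \<longlonglongrightarrow> (\<integral>Z. RL Z \<partial>Pr)"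
  proof -
    have "AE Z in Pr. (\<lambda>n. R (\<lambda>s. u s Z) n) \<longlonglongrightarrow> RL Z" using key by eventually_elim blast
    moreover have "AE Z in Pr. norm (R (\<lambda>s. u s Z) n) \<le> (b - a) * (real N * M)" for n
      using R_bound[OF u_bound] by simp
    ultimately show "integrable Pr RL" "(\<lambda>n. \<integral>Z. R (\<lambda>s. u s Z) n \<partial>Pr) \<longlonglongrightarrow> (\<integral>Z. RL Z \<partial>Pr)"
      using integrable_dominated_convergence[OF RL_m R_m, of "\<lambda>_. (b - a) * (real N * M)"]
        integral_dominated_convergence[OF RL_m R_m, of "\<lambda>_. (b - a) * (real N * M)"] by auto
  qed
  \<comment> \<open>For finite sums, expectation and time grid commute by linearity; the interchange
    of integrals is obtained by letting n grow on both sides.\<close>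
  have "(\<integral>Z. R (\<lambda>s. u s Z) n \<partial>Pr) = real N * R A n" for n
    unfolding R_def using node u_int u_E
    by (subst Bochner_Integration.integral_mult_right_zero, subst Bochner_Integration.integral_sum)
      (auto simp: sum_distrib_left mult_ac)
  moreover have "(\<lambda>n. real N * R A n) \<longlonglongrightarrow> real N * integral {a..b} A"
    unfolding R_def
    by (intro tendsto_mult_left riemann_sums_tendsto(2)[OF \<open>a < b\<close> A_bound negligible_empty])
      (use A_cont in \<open>auto simp: continuous_on_eq_continuous_within\<close>)
  ultimately have eq: "(\<integral>Z. RL Z \<partial>Pr) = real N * integral {a..b} A"
    using DCT(2) by (auto intro: LIMSEQ_unique)
  have V: "integrable Pr (\<lambda>Z. virial N s (\<psi> s Z))" "(\<integral>Z. virial N s (\<psi> s Z) \<partial>Pr) = real N * B s"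
    if s: "s \<in> {a..b}" and ip: "integrable lebesgue (\<lambda>z. phase_virial s z * first_marginal \<epsilon> N (F s) z)" for s
  proof -
    have i: "integrable Pr (\<lambda>Z. phase_virial s (\<psi> s Z i))" if "i \<in> {1..N}" for i
      using E1(1)[OF s that borel_measurable_phase_virial] ip by blast
    then show "integrable Pr (\<lambda>Z. virial N s (\<psi> s Z))"
      unfolding virial_eq_sum by (intro Bochner_Integration.integrable_sum)
    show "(\<integral>Z. virial N s (\<psi> s Z) \<partial>Pr) = real N * B s"
      unfolding virial_eq_sum B_def using i E1(2)[OF s _ borel_measurable_phase_virial]
      by (subst Bochner_Integration.integral_sum) auto
  qed
  assume int: "integrable lebesgue (\<lambda>z. phase_virial a z * first_marginal \<epsilon> N (F a) z)"
    "integrable lebesgue (\<lambda>z. phase_virial b z * first_marginal \<epsilon> N (F b) z)"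
  have "\<bar>\<integral>Z. RL Z \<partial>Pr\<bar> \<le> (\<integral>Z. \<bar>RL Z\<bar> \<partial>Pr)" by (rule integral_abs_bound)
  also have "\<dots> \<le> (\<integral>Z. 2 * L / \<epsilon> * (virial N b (\<psi> b Z) - virial N a (\<psi> a Z)) \<partial>Pr)"
  proof (rule integral_mono_AE)
    show "AE Z in Pr. \<bar>RL Z\<bar> \<le> 2 * L / \<epsilon> * (virial N b (\<psi> b Z) - virial N a (\<psi> a Z))"
      using key by eventually_elim blast
  qed (use DCT(1) V(1) int \<open>a < b\<close> in auto)
  also have "\<dots> = 2 * L / \<epsilon> * (real N * B b - real N * B a)"
    using V int \<open>a < b\<close> by simp
  finally have "real N * \<bar>integral {a..b} A\<bar> \<le> real N * (2 * L / \<epsilon> * (B b - B a))"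
    unfolding eq by (simp add: abs_mult diff_divide_distrib algebra_simps)
  then show "\<bar>integral {a..b} A\<bar> \<le> 2 * L / \<epsilon> * (B b - B a)"
    by (rule mult_left_le_imp_le) (use \<open>N \<ge> 1\<close> in simp)
qed

section \<open>The limit\<close>

text \<open>The function is the pointwise limit of its restrictions to growing balls, each of which
  is integrable.\<close>

lemma borel_measurable_locally_integrable:
  assumes "locally_integrable UNIV g"
  shows "g \<in> borel_measurable lebesgue"
proof (rule borel_measurable_LIMSEQ_real)
  fix n :: nat
  have "g absolutely_integrable_on cball 0 (real n)"
    using assms by (simp add: locally_integrable_def)
  then show "(\<lambda>z. indicator (cball 0 (real n)) z *\<^sub>R g z) \<in> borel_measurable lebesgue"
    unfolding set_integrable_def by (rule borel_measurable_integrable)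
next
  fix z :: 'a
  obtain m :: nat where m: "norm z \<le> real m" using real_arch_simple by blast
  have "\<forall>\<^sub>F n in sequentially. indicator (cball 0 (real n)) z *\<^sub>R g z = g z"
    using eventually_ge_at_top[of m]
    by eventually_elim (use m in \<open>auto simp: indicator_def dist_norm\<close>)
  then show "(\<lambda>n. indicator (cball 0 (real n)) z *\<^sub>R g z) \<longlonglongrightarrow> g z"
    by (rule tendsto_eventually)
qed

text \<open>Fubini's theorem for completed Lebesgue measure, through a Borel representative. The
  outer integral is a gauge integral over the time interval, the form in which the limit of the time
  averages arises.\<close>

lemma integral_lebesgue_time_slices:
  fixes G :: "real \<times> 'b::euclidean_space \<Rightarrow> real"
  assumes G: "integrable lebesgue G" and outside: "\<And>t z. t \<notin> {a..b} \<Longrightarrow> G (t, z) = 0"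
  shows "(\<integral>p. G p \<partial>lebesgue) = integral {a..b} (\<lambda>t. \<integral>z. G (t, z) \<partial>lebesgue)"
proof -
  obtain G' where G': "G' \<in> borel_measurable lborel" "AE p in lborel. G p = G' p"
    using completion_ex_borel_measurable_real[OF borel_measurable_integrable[OF G]] by blast
  have m': "G' \<in> borel_measurable lebesgue" using G'(1) by (rule measurable_completion)
  have ae: "AE p in lebesgue. G p = G' p" using G'(2) by (rule AE_completion)
  have "integrable lebesgue G'"
    using integrable_cong_AE[OF borel_measurable_integrable[OF G] m' ae] G by simp
  then have int': "integrable (lborel \<Otimes>\<^sub>M lborel) G'"
    using integrable_completion[OF G'(1)] by (simp add: lborel_prod)
  have "(\<integral>p. G p \<partial>lebesgue) = (\<integral>p. G' p \<partial>lebesgue)"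
    by (rule integral_cong_AE[OF borel_measurable_integrable[OF G] m' ae])
  also have "\<dots> = (\<integral>p. G' p \<partial>lborel)" using G'(1) by (rule integral_completion)
  also have "\<dots> = (\<integral>t. (\<integral>z. G' (t, z) \<partial>lborel) \<partial>lborel)"
    using lborel_pair.integral_fst'[OF int'] by (simp add: lborel_prod)
  also have "\<dots> = integral UNIV (\<lambda>t. \<integral>z. G' (t, z) \<partial>lborel)"
    using lborel_pair.integrable_fst'[OF int'] by (rule integral_lborel[symmetric])
  \<comment> \<open>Almost every time slice of \<open>G\<close> agrees almost everywhere with that
    of \<open>G'\<close>; the remaining times are negligible and invisible to the gauge
    integral.\<close>
  also have "\<dots> = integral UNIV (\<lambda>t. if t \<in> {a..b} then (\<integral>z. G (t, z) \<partial>lebesgue) else 0)"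
  proof -
    have "AE p in lborel \<Otimes>\<^sub>M lborel. G p = G' p" using G'(2) unfolding lborel_prod .
    then have "AE t in lborel. AE z in lborel. G (t, z) = G' (t, z)"
      by (rule lborel_pair.AE_pair)
    then have "AE t in lborel. (\<integral>z. G (t, z) \<partial>lebesgue) = (\<integral>z. G' (t, z) \<partial>lborel)"
    proof eventually_elim
      fix t assume s: "AE z in lborel. G (t, z) = G' (t, z)"
      have "G' \<in> borel_measurable (lborel \<Otimes>\<^sub>M lborel)" using G'(1) by (simp add: lborel_prod)
      then have n: "(\<lambda>z. G' (t, z)) \<in> borel_measurable lborel"
        using measurable_compose[OF measurable_Pair1'[of t lborel lborel]] by simp
      then have n': "(\<lambda>z. G' (t, z)) \<in> borel_measurable lebesgue" by (rule measurable_completion)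
      have s': "AE z in lebesgue. G' (t, z) = G (t, z)"
        using AE_completion[OF s] by (simp add: eq_commute)
      have "(\<integral>z. G (t, z) \<partial>lebesgue) = (\<integral>z. G' (t, z) \<partial>lebesgue)"
        by (rule integral_cong_AE[OF completion.borel_measurable_cong_AE[OF n' s'] n' AE_completion[OF s]])
      then show "(\<integral>z. G (t, z) \<partial>lebesgue) = (\<integral>z. G' (t, z) \<partial>lborel)"
        using integral_completion[OF n] by simp
    qed
    from AE_E[OF this] obtain S where S':
      "{t \<in> space lborel. \<not> ((\<integral>z. G (t, z) \<partial>lebesgue) = (\<integral>z. G' (t, z) \<partial>lborel))} \<subseteq> S"
      "emeasure lborel S = 0" "S \<in> sets lborel" by blast
    have S: "S \<in> null_sets lborel" using S'(2,3) by (rule null_setsI)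
    show ?thesis
    proof (rule integral_spike[where S = S])
      show "negligible S"
        using null_sets_completionI[OF S] by (simp add: negligible_iff_null_sets)
      fix t assume "t \<in> UNIV - S"
      then have "(\<integral>z. G (t, z) \<partial>lebesgue) = (\<integral>z. G' (t, z) \<partial>lborel)" using S'(1) by auto
      then show "(if t \<in> {a..b} then (\<integral>z. G (t, z) \<partial>lebesgue) else 0) = (\<integral>z. G' (t, z) \<partial>lborel)"
        using outside by auto
    qed
  qed
  also have "\<dots> = integral {a..b} (\<lambda>t. \<integral>z. G (t, z) \<partial>lebesgue)"
    by (rule integral_restrict_UNIV)
  finally show ?thesis .
qed

section \<open>Control of the virial by second moments\<close>

text \<open>In the constant, 1 comes from Cauchy-Schwarz for x . v and \<open>T\<close> from the
  kinetic term.\<close>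

lemma abs_phase_virial_le:
  assumes "0 \<le> t" "t \<le> T"
  shows "\<bar>phase_virial t (x, v)\<bar> \<le> (1 + T) * ((norm x)\<^sup>2 + (norm v)\<^sup>2)"
proof -
  have "\<bar>x \<bullet> v\<bar> \<le> norm x * norm v" by (rule Cauchy_Schwarz_ineq2)
  also have "\<dots> \<le> (norm x)\<^sup>2 + (norm v)\<^sup>2"
  proof -
    have "2 * (norm x * norm v) \<le> (norm x)\<^sup>2 + (norm v)\<^sup>2"
      using sum_squares_bound[of "norm x" "norm v"] by simp
    moreover have "0 \<le> norm x * norm v" by simp
    ultimately show ?thesis by linarith
  qed
  finally have "\<bar>x \<bullet> v\<bar> \<le> (norm x)\<^sup>2 + (norm v)\<^sup>2" .
  moreover have "(norm v)\<^sup>2 * t \<le> ((norm x)\<^sup>2 + (norm v)\<^sup>2) * T"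
    using assms by (intro mult_mono) auto
  moreover have "0 \<le> (norm v)\<^sup>2 * t" using assms by simp
  ultimately show ?thesis
    unfolding phase_virial_def by (simp add: algebra_simps)
qed

text \<open>To be used with \<open>g\<close> the first marginal and \<open>h\<close> the limit:
  integrability of the virial is given for the limit only, and passes to the marginal because the
  difference is integrable by the weighted distance.\<close>

lemma virial_perturbation:
  fixes g h :: "'a::euclidean_space \<times> 'a \<Rightarrow> real"
  assumes meas: "g \<in> borel_measurable lebesgue" "h \<in> borel_measurable lebesgue"
    and t: "0 \<le> t" "t \<le> T" and "0 \<le> \<delta>"
    and int: "integrable lebesgue (\<lambda>z. phase_virial t z * h z)"
    and dist: "(\<integral>\<^sup>+ (x, v). ennreal (((norm x)\<^sup>2 + (norm v)\<^sup>2) * \<bar>g (x, v) - h (x, v)\<bar>) \<partial>lebesgue) \<le> ennreal \<delta>"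
  shows "integrable lebesgue (\<lambda>z. phase_virial t z * g z)"
    and "\<bar>(\<integral>z. phase_virial t z * g z \<partial>lebesgue) - (\<integral>z. phase_virial t z * h z \<partial>lebesgue)\<bar> \<le> (1 + T) * \<delta>"
proof -
  have m: "(\<lambda>z. phase_virial t z * (g z - h z)) \<in> borel_measurable lebesgue"
    using meas measurable_completion[of "phase_virial t" lborel borel] borel_measurable_phase_virial[of t]
    by (intro borel_measurable_times borel_measurable_diff) auto
  have b: "(\<integral>\<^sup>+ z. ennreal (norm (phase_virial t z * (g z - h z))) \<partial>lebesgue) \<le> ennreal ((1 + T) * \<delta>)"
  proof -
    have "(\<integral>\<^sup>+ z. ennreal (norm (phase_virial t z * (g z - h z))) \<partial>lebesgue)
      \<le> (\<integral>\<^sup>+ z. ennreal (1 + T) * (case z of (x, v) \<Rightarrow>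
            ennreal (((norm x)\<^sup>2 + (norm v)\<^sup>2) * \<bar>g (x, v) - h (x, v)\<bar>)) \<partial>lebesgue)"
    proof (rule nn_integral_mono)
      fix z :: "'a \<times> 'a"
      obtain x v where z: "z = (x, v)" by (cases z)
      have "norm (phase_virial t z * (g z - h z)) \<le> (1 + T) * ((norm x)\<^sup>2 + (norm v)\<^sup>2) * \<bar>g z - h z\<bar>"
        unfolding z using abs_phase_virial_le[OF t, of x v] by (simp add: abs_mult mult_right_mono)
      moreover have "ennreal (1 + T) * ennreal y = ennreal ((1 + T) * y)" for y
        by (rule ennreal_mult'[symmetric]) (use t in simp)
      ultimately show "ennreal (norm (phase_virial t z * (g z - h z))) \<le> ennreal (1 + T) * (case z of (x, v) \<Rightarrow>
            ennreal (((norm x)\<^sup>2 + (norm v)\<^sup>2) * \<bar>g (x, v) - h (x, v)\<bar>))"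
        unfolding z prod.case by (simp only: mult.assoc ennreal_leI)
    qed
    also have "\<dots> = ennreal (1 + T) * (\<integral>\<^sup>+ (x, v).
            ennreal (((norm x)\<^sup>2 + (norm v)\<^sup>2) * \<bar>g (x, v) - h (x, v)\<bar>) \<partial>lebesgue)"
    proof (rule nn_integral_cmult)
      have "(\<lambda>z :: 'a \<times> 'a. (norm (fst z))\<^sup>2 + (norm (snd z))\<^sup>2) \<in> borel_measurable borel"
        by (intro borel_measurable_continuous_onI continuous_intros)
      then have "(\<lambda>z :: 'a \<times> 'a. (norm (fst z))\<^sup>2 + (norm (snd z))\<^sup>2) \<in> borel_measurable lebesgue"
        by (simp add: measurable_completion)
      then have "(\<lambda>z. ennreal (((norm (fst z))\<^sup>2 + (norm (snd z))\<^sup>2) * \<bar>g z - h z\<bar>)) \<in> borel_measurable lebesgue"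
        using meas by measurable
      then show "(\<lambda>(x, v). ennreal (((norm x)\<^sup>2 + (norm v)\<^sup>2) * \<bar>g (x, v) - h (x, v)\<bar>)) \<in> borel_measurable lebesgue"
        by (simp add: case_prod_beta')
    qed
    also have "\<dots> \<le> ennreal (1 + T) * ennreal \<delta>" using dist by (rule mult_left_mono) simp
    also have "\<dots> = ennreal ((1 + T) * \<delta>)" using t \<open>0 \<le> \<delta>\<close> by (simp add: ennreal_mult')
    finally show ?thesis .
  qed
  have i: "integrable lebesgue (\<lambda>z. phase_virial t z * (g z - h z))"
    using m b le_less_trans[OF b ennreal_less_top] by (intro integrableI_bounded) auto
  have eq: "(\<lambda>z. phase_virial t z * g z) = (\<lambda>z. phase_virial t z * h z + phase_virial t z * (g z - h z))"
    by (simp add: algebra_simps)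
  show "integrable lebesgue (\<lambda>z. phase_virial t z * g z)"
    unfolding eq using int i by (rule Bochner_Integration.integrable_add)
  have "(\<integral>z. phase_virial t z * g z \<partial>lebesgue) - (\<integral>z. phase_virial t z * h z \<partial>lebesgue)
    = (\<integral>z. phase_virial t z * (g z - h z) \<partial>lebesgue)"
    unfolding eq using int i by simp
  moreover have "ennreal \<bar>\<integral>z. phase_virial t z * (g z - h z) \<partial>lebesgue\<bar> \<le> ennreal ((1 + T) * \<delta>)"
    using order_trans[OF integral_norm_bound_ennreal[OF i] b] by simp
  ultimately show "\<bar>(\<integral>z. phase_virial t z * g z \<partial>lebesgue) - (\<integral>z. phase_virial t z * h z \<partial>lebesgue)\<bar> \<le> (1 + T) * \<delta>"
    using t \<open>0 \<le> \<delta>\<close> by (simp add: ennreal_le_iff)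
qed

theorem theorem6p1:
  fixes \<epsilon> :: "nat \<Rightarrow> real"
    and \<psi> :: "nat \<Rightarrow> real \<Rightarrow> (real^'d) config \<Rightarrow> (real^'d) config"
    and F :: "nat \<Rightarrow> real \<Rightarrow> (real^'d) config \<Rightarrow> real"
    and f :: "real \<Rightarrow> (real^'d) \<times> (real^'d) \<Rightarrow> real"
    and T T1 T2 :: real
  assumes boltzmann_grad: "\<forall>N\<ge>1. \<epsilon> N > 0 \<and> real N * \<epsilon> N ^ (CARD('d) - 1) = 1"
    and flow: "\<forall>N\<ge>1. hs_flow (\<epsilon> N) N (\<psi> N)"
    and density: "\<forall>N\<ge>1. \<forall>t\<in>{0..T}. probability_density (hs_measure (\<epsilon> N) N) (F N t)"
    and liouville: "\<forall>N\<ge>1. \<forall>t\<in>{0..T}.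
      AE Z in hs_measure (\<epsilon> N) N. F N t Z = F N 0 (\<psi> N (- t) Z)"
    and symmetric: "\<forall>N\<ge>1. \<forall>t\<in>{0..T}. \<forall>\<sigma>. \<sigma> permutes {1..N} \<longrightarrow>
      (AE Z in hs_measure (\<epsilon> N) N. F N t (Z \<circ> \<sigma>) = F N t Z)"
    and moments: "(SUP N\<in>{1..}. (\<integral>\<^sup>+ Z. ennreal
        ((\<Sum>i=1..N. (norm (fst (Z i)))\<^sup>2 + (norm (snd (Z i)))\<^sup>2) * F N 0 Z)
        \<partial>hs_measure (\<epsilon> N) N) / of_nat N) < \<infinity>"
    and boltzmann: "boltzmann_solution T f"
    and virial: "\<forall>t\<in>{0..T}.
      integrable lebesgue (\<lambda>(x, v). (x \<bullet> v - (norm v)\<^sup>2 * t) * f t (x, v)) \<and>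
      (\<integral>(x, v). (x \<bullet> v - (norm v)\<^sup>2 * t) * f t (x, v) \<partial>lebesgue)
        = (\<integral>(x, v). (x \<bullet> v) * f 0 (x, v) \<partial>lebesgue)"
    and not_free: "\<forall>a b. 0 \<le> a \<and> a < b \<and> b \<le> T \<longrightarrow> \<not> free_transport_on a b f"
    and convergence: "\<forall>t\<in>{0..T}.
      tendsto_distribution (\<lambda>N. first_marginal (\<epsilon> N) N (F N t)) (f t)"
    and times: "0 \<le> T1" "T1 < T2" "T2 \<le> T"
  shows "liminf (\<lambda>N. (SUP t\<in>{T1..T2}.
      \<integral>\<^sup>+ (x, v). ennreal (((norm x)\<^sup>2 + (norm v)\<^sup>2) *
        \<bar>first_marginal (\<epsilon> N) N (F N t) (x, v) - f t (x, v)\<bar>) \<partial>lebesgue) / ennreal (\<epsilon> N)) > 0"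
proof (rule ccontr)
  define U where "U N = (SUP t\<in>{T1..T2}.
      \<integral>\<^sup>+ (x, v). ennreal (((norm x)\<^sup>2 + (norm v)\<^sup>2) *
        \<bar>first_marginal (\<epsilon> N) N (F N t) (x, v) - f t (x, v)\<bar>) \<partial>lebesgue)" for N
  assume "\<not> liminf (\<lambda>N. (SUP t\<in>{T1..T2}.
      \<integral>\<^sup>+ (x, v). ennreal (((norm x)\<^sup>2 + (norm v)\<^sup>2) *
        \<bar>first_marginal (\<epsilon> N) N (F N t) (x, v) - f t (x, v)\<bar>) \<partial>lebesgue) / ennreal (\<epsilon> N)) > 0"
  then have lim0: "liminf (\<lambda>N. U N / ennreal (\<epsilon> N)) = 0" unfolding U_def by simp
  \<comment> \<open>A vanishing liminf gives smallness for infinitely many N only, hence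
    \<open>frequently\<close>; this is enough, as it is later combined with statements that hold
    eventually.\<close>
  have freq: "\<exists>\<^sub>F N in sequentially. U N / ennreal (\<epsilon> N) < ennreal \<eta>" if "\<eta> > 0" for \<eta>
  proof (rule ccontr)
    assume "\<not> (\<exists>\<^sub>F N in sequentially. U N / ennreal (\<epsilon> N) < ennreal \<eta>)"
    then have "\<forall>\<^sub>F N in sequentially. ennreal \<eta> \<le> U N / ennreal (\<epsilon> N)"
      by (simp add: not_frequently not_less)
    then have "ennreal \<eta> \<le> liminf (\<lambda>N. U N / ennreal (\<epsilon> N))" by (rule Liminf_bounded)
    then show False using \<open>\<eta> > 0\<close> unfolding lim0 by simp
  qed
  have sub: "t \<in> {0..T}" if "t \<in> {T1..T2}" for t using that times by auto
  have ends: "T1 \<in> {T1..T2}" "T2 \<in> {T1..T2}" using times by auto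
  have f_meas: "f t \<in> borel_measurable lebesgue" if "t \<in> {0..T}" for t
    using boltzmann that unfolding boltzmann_solution_def
    by (intro borel_measurable_locally_integrable) blast
  have "free_transport_on T1 T2 f"
    unfolding free_transport_on_def transport_equation_def
  proof (intro allI impI)
    fix \<phi> :: "real \<times> (real^'d) \<times> (real^'d) \<Rightarrow> real"
    assume test: "test_function ({T1<..<T2} \<times> UNIV) \<phi>"
    define K where "K = closure {p. \<phi> p \<noteq> 0}"
    have K: "compact K" "K \<subseteq> {T1<..<T2} \<times> UNIV"
      using test by (auto simp: test_function_def K_def)
    have zero: "transport_derivative \<phi> p = 0" if "p \<notin> K" for p
      using frechet_derivative_zero_outside_support[of p \<phi>] that
      by (simp add: transport_derivative_def K_def)
    have cont: "continuous_on UNIV (transport_derivative \<phi>)"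
    proof -
      have "Ck (Suc 0) \<phi>" using test unfolding test_function_def by blast
      from Ck_transport_derivative[OF this] show ?thesis by simp
    qed
    obtain M where M: "M > 0" "\<And>p. \<bar>transport_derivative \<phi> p\<bar> \<le> M"
      using bounded_of_compact_support[OF cont K(1) zero] by blast
    obtain L where L: "L > 0" "\<And>p q. \<bar>\<phi> p - \<phi> q\<bar> \<le> L * norm (p - q)"
      using test_function_lipschitz[OF test] by blast
    define A where "A N s = (\<integral>z. transport_derivative \<phi> (s, z) * first_marginal (\<epsilon> N) N (F N s) z \<partial>lebesgue)" for N s
    define a where "a s = (\<integral>z. f s z * transport_derivative \<phi> (s, z) \<partial>lebesgue)" for s
    define B where "B N s = (\<integral>z. phase_virial s z * first_marginal (\<epsilon> N) N (F N s) z \<partial>lebesgue)" for N s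
    have eps: "\<epsilon> N > 0" if "N \<ge> 1" for N using boltzmann_grad that by blast
    have flow': "hs_flow (\<epsilon> N) N (\<psi> N)" if "N \<ge> 1" for N using flow that by blast
    have pd0: "probability_density (hs_measure (\<epsilon> N) N) (F N 0)" if "N \<ge> 1" for N
      using density that times by auto
    have pd: "probability_density (hs_measure (\<epsilon> N) N) (F N t)" if "N \<ge> 1" "t \<in> {T1..T2}" for N t
      using density that sub by blast
    have liou: "AE Z in hs_measure (\<epsilon> N) N. F N t Z = F N 0 (\<psi> N (- t) Z)" if "N \<ge> 1" "t \<in> {T1..T2}" for N t
      using liouville that sub by blast
    have sym: "AE Z in hs_measure (\<epsilon> N) N. F N t (Z \<circ> \<sigma>) = F N t Z"
      if "N \<ge> 1" "t \<in> {T1..T2}" "\<sigma> permutes {1..N}" for N t \<sigma>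
      using symmetric that sub by blast
    have weak: "continuous_on {T1..T2} (A N)" "\<And>s. s \<in> {T1..T2} \<Longrightarrow> \<bar>A N s\<bar> \<le> M"
      "integrable lebesgue (\<lambda>z. phase_virial T1 z * first_marginal (\<epsilon> N) N (F N T1) z) \<Longrightarrow>
       integrable lebesgue (\<lambda>z. phase_virial T2 z * first_marginal (\<epsilon> N) N (F N T2) z) \<Longrightarrow>
       \<bar>integral {T1..T2} (A N)\<bar> \<le> 2 * L / \<epsilon> N * (B N T2 - B N T1)"
      if N: "N \<ge> 1" for N
    proof -
      note bounds = hs_weak_transport_bound[OF flow'[OF N] N eps[OF N] \<open>T1 < T2\<close>
          pd0[OF N] pd[OF N] liou[OF N] sym[OF N] test L(2) M(2)]
      show "continuous_on {T1..T2} (A N)"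
        using bounds(1) unfolding A_def[abs_def] .
      show "\<bar>A N s\<bar> \<le> M" if "s \<in> {T1..T2}" for s
        unfolding A_def[abs_def] by (rule bounds(2)) (assumption | rule that)+
      assume int: "integrable lebesgue (\<lambda>z. phase_virial T1 z * first_marginal (\<epsilon> N) N (F N T1) z)"
        "integrable lebesgue (\<lambda>z. phase_virial T2 z * first_marginal (\<epsilon> N) N (F N T2) z)"
      show "\<bar>integral {T1..T2} (A N)\<bar> \<le> 2 * L / \<epsilon> N * (B N T2 - B N T1)"
        unfolding A_def[abs_def] B_def by (rule bounds(3)) (assumption | rule int)+
    qed
    \<comment> \<open>Origin of the constant: 2 L / \<epsilon> from the weak transport bound, times
      2 (1 + T) \<eta> \<epsilon>, the errors of the mean virial at both end times. The factors
      \<epsilon> cancel.\<close>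
    have small: "\<bar>integral {T1..T2} (A N)\<bar> \<le> 4 * L * (1 + T) * \<eta>" if "N \<ge> 1" "\<eta> > 0" "U N / ennreal (\<epsilon> N) < ennreal \<eta>" for N \<eta>
    proof -
      define \<delta> where "\<delta> = \<eta> * \<epsilon> N"
      have "\<delta> \<ge> 0" using that eps[OF that(1)] by (simp add: \<delta>_def)
      have "U N = U N * ennreal (\<epsilon> N) / ennreal (\<epsilon> N)"
        using eps[OF that(1)] by (intro mult_divide_eq_ennreal[symmetric]) auto
      also have "\<dots> = U N / ennreal (\<epsilon> N) * ennreal (\<epsilon> N)"
        by (simp add: divide_ennreal_def mult_ac)
      also have "\<dots> \<le> ennreal \<eta> * ennreal (\<epsilon> N)"
        using that(3) by (intro mult_right_mono) auto
      also have "\<dots> = ennreal \<delta>"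
        using \<open>\<eta> > 0\<close> by (simp add: \<delta>_def ennreal_mult')
      finally have U: "U N \<le> ennreal \<delta>" .
      \<comment> \<open>The virial of the limit has this same value at both end times, so it
        disappears from the difference of \<open>B N T2\<close> and \<open>B N T1\<close>.\<close>
      define c where "c = (\<integral>(x, v). (x \<bullet> v) * f 0 (x, v) \<partial>lebesgue)"
      have pert: "integrable lebesgue (\<lambda>z. phase_virial t z * first_marginal (\<epsilon> N) N (F N t) z)"
        "\<bar>B N t - c\<bar> \<le> (1 + T) * \<delta>" if t: "t \<in> {T1..T2}" for t
      proof -
        have t0: "0 \<le> t" "t \<le> T" using sub[OF t] by auto
        have "(\<integral>\<^sup>+ (x, v). ennreal (((norm x)\<^sup>2 + (norm v)\<^sup>2) *
            \<bar>first_marginal (\<epsilon> N) N (F N t) (x, v) - f t (x, v)\<bar>) \<partial>lebesgue) \<le> U N"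
          unfolding U_def using t by (rule SUP_upper)
        also note U
        finally have dist: "(\<integral>\<^sup>+ (x, v). ennreal (((norm x)\<^sup>2 + (norm v)\<^sup>2) *
            \<bar>first_marginal (\<epsilon> N) N (F N t) (x, v) - f t (x, v)\<bar>) \<partial>lebesgue) \<le> ennreal \<delta>" .
        have pv: "(\<lambda>(x, v). (x \<bullet> v - (norm v)\<^sup>2 * t) * f t (x, v)) = (\<lambda>z. phase_virial t z * f t z)"
          by (simp add: fun_eq_iff phase_virial_def)
        have vi: "integrable lebesgue (\<lambda>z. phase_virial t z * f t z)"
          "(\<integral>z. phase_virial t z * f t z \<partial>lebesgue) = c"
          using virial[rule_format, OF sub[OF t]] unfolding pv c_def by blast+
        note p = virial_perturbation[OF borel_measurable_first_marginal[OF \<open>N \<ge> 1\<close> pd[OF \<open>N \<ge> 1\<close> t]]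
            f_meas[OF sub[OF t]] t0 \<open>\<delta> \<ge> 0\<close> vi(1) dist]
        show "integrable lebesgue (\<lambda>z. phase_virial t z * first_marginal (\<epsilon> N) N (F N t) z)"
          by (rule p(1))
        show "\<bar>B N t - c\<bar> \<le> (1 + T) * \<delta>"
          using p(2) unfolding vi(2) B_def .
      qed
      have "\<bar>integral {T1..T2} (A N)\<bar> \<le> 2 * L / \<epsilon> N * (B N T2 - B N T1)"
        by (rule weak(3)[OF \<open>N \<ge> 1\<close> pert(1)[OF ends(1)] pert(1)[OF ends(2)]])
      also have "\<dots> \<le> 2 * L / \<epsilon> N * (2 * ((1 + T) * \<delta>))"
        using pert(2)[OF ends(1)] pert(2)[OF ends(2)] eps[OF \<open>N \<ge> 1\<close>] \<open>L > 0\<close>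
        by (intro mult_left_mono) auto
      also have "\<dots> = 4 * L * (1 + T) * \<eta>"
        using eps[OF \<open>N \<ge> 1\<close>] by (simp add: \<delta>_def field_simps)
      finally show ?thesis .
    qed
    have lim: "(\<lambda>N. integral {T1..T2} (A (Suc N))) \<longlonglongrightarrow> integral {T1..T2} a"
    proof (rule dominated_convergence(2)[where h = "\<lambda>_. M"])
      fix k
      have k: "Suc k \<ge> 1" by simp
      have "continuous_on {T1..T2} (A (Suc k))"
        by (rule weak(1)[OF k])
      then show "A (Suc k) integrable_on {T1..T2}" by (rule integrable_continuous_real)
      show "norm (A (Suc k) t) \<le> M" if "t \<in> {T1..T2}" for t
        using weak(2)[OF k that] by simp
    next
      fix t assume t: "t \<in> {T1..T2}"
      have "(\<lambda>N. \<integral>z. first_marginal (\<epsilon> N) N (F N t) z * transport_derivative \<phi> (t, z) \<partial>lebesgue) \<longlonglongrightarrow> a t"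
        unfolding a_def
        using convergence[rule_format, OF sub[OF t]] test_function_transport_derivative_slice[OF test, of t]
        unfolding tendsto_distribution_def by blast
      then have "(\<lambda>N. A N t) \<longlonglongrightarrow> a t" unfolding A_def by (simp add: mult.commute)
      then show "(\<lambda>k. A (Suc k) t) \<longlonglongrightarrow> a t" by (rule LIMSEQ_Suc)
    qed (rule integrable_const_ivl)
    have "integral {T1..T2} a = 0"
    proof (rule ccontr)
      define I where "I = \<bar>integral {T1..T2} a\<bar>"
      assume "integral {T1..T2} a \<noteq> 0"
      then have "I > 0" by (simp add: I_def)
      define C where "C = 4 * L * (1 + T)"
      have "C > 0" using \<open>L > 0\<close> times by (simp add: C_def)
      \<comment> \<open>With this choice \<open>C * \<eta>\<close> is I / 2, while convergence
        forces the absolute value of the integral of \<open>A N\<close> above I / 2.\<close>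
      define \<eta> where "\<eta> = I / (2 * C)"
      have "\<eta> > 0" using \<open>I > 0\<close> \<open>C > 0\<close> by (simp add: \<eta>_def)
      have "(\<lambda>N. integral {T1..T2} (A N)) \<longlonglongrightarrow> integral {T1..T2} a"
        by (rule LIMSEQ_imp_Suc[OF lim])
      then have "\<forall>\<^sub>F N in sequentially. dist (integral {T1..T2} (A N)) (integral {T1..T2} a) < I / 2"
        using \<open>I > 0\<close> by (intro tendstoD) auto
      with eventually_ge_at_top[of 1]
      have "\<forall>\<^sub>F N in sequentially. N \<ge> 1 \<and> dist (integral {T1..T2} (A N)) (integral {T1..T2} a) < I / 2"
        by eventually_elim simp
      from frequently_eventually_conj[OF freq[OF \<open>\<eta> > 0\<close>] this]
      obtain N where N: "U N / ennreal (\<epsilon> N) < ennreal \<eta>" "N \<ge> 1"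
        "dist (integral {T1..T2} (A N)) (integral {T1..T2} a) < I / 2"
        by (auto dest: frequently_ex)
      have "\<bar>integral {T1..T2} (A N)\<bar> \<le> C * \<eta>"
        unfolding C_def by (rule small[OF N(2) \<open>\<eta> > 0\<close> N(1)])
      also have "\<dots> = I / 2" using \<open>C > 0\<close> by (simp add: \<eta>_def)
      finally show False using N(3) unfolding I_def dist_real_def by linarith
    qed
    define G where "G p = f (fst p) (snd p) * transport_derivative \<phi> p" for p
    \<comment> \<open>In space-time \<open>f\<close> is only locally integrable; the transport
      derivative is bounded and vanishes off the compact set \<open>K\<close>, which lies in the
      open strip between times 0 and \<open>T\<close>.\<close>
    have int: "integrable lebesgue G"
    proof -
      have "(\<lambda>(t, z). f t z) absolutely_integrable_on K"
      proof -
        have "K \<subseteq> {0<..<T} \<times> UNIV" using K(2) times by auto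
        then show ?thesis
          using boltzmann K(1) unfolding boltzmann_solution_def locally_integrable_def by blast
      qed
      then have fK: "integrable lebesgue (\<lambda>p. indicator K p * f (fst p) (snd p))"
        by (simp add: set_integrable_def case_prod_beta')
      have td: "transport_derivative \<phi> \<in> borel_measurable lebesgue"
        using borel_measurable_continuous_onI[OF cont] by (simp add: measurable_completion)
      have G: "G = (\<lambda>p. transport_derivative \<phi> p * (indicator K p * f (fst p) (snd p)))"
        using zero by (auto simp: G_def fun_eq_iff indicator_def)
      show ?thesis
        unfolding G
      proof (rule Bochner_Integration.integrable_bound[OF integrable_mult_right[OF fK, of M]])
        show "(\<lambda>p. transport_derivative \<phi> p * (indicator K p * f (fst p) (snd p))) \<in> borel_measurable lebesgue"
          using td borel_measurable_integrable[OF fK] by (rule borel_measurable_times)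
        show "AE p in lebesgue. norm (transport_derivative \<phi> p * (indicator K p * f (fst p) (snd p)))
            \<le> norm (M * (indicator K p * f (fst p) (snd p)))"
        proof (rule AE_I2)
          fix p
          have "\<bar>transport_derivative \<phi> p\<bar> \<le> \<bar>M\<bar>" using M(2)[of p] by linarith
          then show "norm (transport_derivative \<phi> p * (indicator K p * f (fst p) (snd p)))
              \<le> norm (M * (indicator K p * f (fst p) (snd p)))"
            unfolding real_norm_def abs_mult by (intro mult_right_mono) auto
        qed
      qed
    qed
    have "(\<integral>p. G p \<partial>lebesgue) = integral {T1..T2} a"
    proof -
      have "G (t, z) = 0" if "t \<notin> {T1..T2}" for t z
      proof -
        have "(t, z) \<notin> K" using K(2) that by auto
        then show ?thesis by (simp add: G_def zero)
      qed
      from integral_lebesgue_time_slices[OF int this] show ?thesis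
        by (simp add: a_def[abs_def] G_def)
    qed
    then show "- (\<integral>(t, x, v). f t (x, v) * frechet_derivative \<phi> (at (t, x, v)) (1, v, 0) \<partial>lebesgue)
        = (\<integral>(t, x, v). 0 * \<phi> (t, x, v) \<partial>lebesgue)"
      using \<open>integral {T1..T2} a = 0\<close>
      by (simp add: G_def[abs_def] transport_derivative_def case_prod_beta')
  qed
  then show False using not_free times by blast
qed

end
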